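(* Let $0<\alpha<2$, $h<0$ and $0<\epsilon<|h|^{-1/\alpha}$. For $\delta\in\{0,\epsilon\}$ let $\Sigma_{h,\delta}$ be the reduced energy surface and consider the reduced flow on the invariant set $\Sigma_{h,\delta}^{*}:=\{(r,v,u)\in\Sigma_{h,\delta} : r>0,\ u\neq 0\}$ (the part of the energy surface outside the collision set, i.e. where the angular momentum $c=u r^{(2-\alpha)/2}$ is non-zero). Then, both for $\delta=0$ (non-smoothed flow) and for $\delta=\epsilon$ (smoothed flow), every orbit in $\Sigma_{h,\delta}^{*}$ is periodic, except for the fixed points $R_\delta^{\pm}$ (one with $u>0$ and one with $u<0$). Moreover, the non-smoothed flow on $\Sigma_{h,0}^{*}$ and the smoothed flow on $\Sigma_{h,\epsilon}^{*}$ are topologically equivalent.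
   Context: A unit-mass particle moves in the plane under the smoothed homogeneous potential $U_\delta(r)=-1/(r^2+\delta^2)^{\alpha/2}$, $\delta\ge 0$ ($\delta=0$ is the non-smoothed, "real", problem), with Hamiltonian $\frac12(p_r^2+p_\theta^2/r^2)+U_\delta(r)$ in polar coordinates. With $u=p_\theta r^{(\alpha-2)/2}$, $v=p_r r^{\alpha/2}$, $d\tau=r^{-(\alpha+2)/2}dt$, and after factoring out the angle $\theta$, the reduced equations on $(r,v,u)\in[0,\infty)\times\mathbb{R}\times\mathbb{R}$ are $$r'=rv,\qquad v'=u^2+\frac{\alpha}{2}v^2-\frac{\alpha r^{\alpha+2}}{(r^2+\delta^2)^{\alpha/2+1}},\qquad u'=\frac{\alpha-2}{2}\,uv,$$ where $'=d/d\tau$ (for $\delta=0$ the last term of $v'$ is the constant $-\alpha$, also at $r=0$). The reduced energy surface for energy $h<0$ is the invariant set $$\Sigma_{h,\delta}=\Big\{(r,v,u)\in[0,\infty)\times\mathbb{R}^2 : u^2+v^2=\frac{2r^\alpha}{(r^2+\delta^2)^{\alpha/2}}-2r^\alpha|h|\Big\}$$ (for $\delta=0$ the right-hand side is $2-2r^\alpha|h|$, also at $r=0$). The quantity $c=u r^{(2-\alpha)/2}$ (angular momentum) is conserved for $r>0$. $R_\delta^{\pm}=(r_\delta,0,\pm u_\delta)$, with $r_\delta>0$ and $u_\delta>0$, denote the fixed points of the reduced flow on $\Sigma_{h,\delta}$ with $r>0$ (relative equilibria). Two flows are topologically equivalent if there is a homeomorphism between their phase spaces mapping orbits onto orbits and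 preserving the direction of time. *)

theory Defs
  imports "HOL-Analysis.Analysis"
begin

section \<open>Flows of autonomous equations restricted to a set\<close>

text \<open>
  Integral curves of \<^term>\<open>x' = F x\<close> that stay in \<^term>\<open>S\<close>, on nonempty open intervals.
  No completeness is built in; \<^term>\<open>S\<close> is meant to be an invariant set of the equation.
\<close>

definition solution_on ::
  "('a::real_normed_vector \<Rightarrow> 'a) \<Rightarrow> 'a set \<Rightarrow> real set \<Rightarrow> (real \<Rightarrow> 'a) \<Rightarrow> bool" where
  "solution_on F S I \<gamma> \<longleftrightarrow>
     open I \<and> is_interval I \<and> I \<noteq> {} \<and>
     (\<forall>t\<in>I. \<gamma> t \<in> S \<and> (\<gamma> has_vector_derivative F (\<gamma> t)) (at t))"

definition maximal_solution ::
  "('a::real_normed_vector \<Rightarrow> 'a) \<Rightarrow> 'a set \<Rightarrow> real set \<Rightarrow> (real \<Rightarrow> 'a) \<Rightarrow> bool" where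
  "maximal_solution F S I \<gamma> \<longleftrightarrow>
     solution_on F S I \<gamma> \<and>
     (\<forall>J \<sigma>. solution_on F S J \<sigma> \<and> I \<subseteq> J \<and> (\<forall>t\<in>I. \<sigma> t = \<gamma> t) \<longrightarrow> J = I)"

text \<open>
  All points reached, forwards or backwards in time, by a solution through \<^term>\<open>x\<close>;
  under uniqueness of solutions this is the image of the maximal solution through \<^term>\<open>x\<close>.
\<close>

definition orbit :: "('a::real_normed_vector \<Rightarrow> 'a) \<Rightarrow> 'a set \<Rightarrow> 'a \<Rightarrow> 'a set" where
  "orbit F S x = {\<gamma> t | \<gamma> I t. solution_on F S I \<gamma> \<and> 0 \<in> I \<and> \<gamma> 0 = x \<and> t \<in> I}"

definition fixed_point :: "('a::real_normed_vector \<Rightarrow> 'a) \<Rightarrow> 'a set \<Rightarrow> 'a \<Rightarrow> bool" where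
  "fixed_point F S x \<longleftrightarrow> orbit F S x = {x}"

text \<open>Fixed points do not count as periodic orbits.\<close>

definition periodic_orbit :: "('a::real_normed_vector \<Rightarrow> 'a) \<Rightarrow> 'a set \<Rightarrow> 'a set \<Rightarrow> bool" where
  "periodic_orbit F S C \<longleftrightarrow>
     (\<exists>\<gamma> T. solution_on F S UNIV \<gamma> \<and> T > 0 \<and> (\<forall>t. \<gamma> (t + T) = \<gamma> t) \<and>
            (\<exists>s t. \<gamma> s \<noteq> \<gamma> t) \<and> C = range \<gamma>)"

text \<open>
  Preservation of the direction of time: every maximal solution is carried to a maximal
  solution up to an increasing continuous bijection of the time intervals.
\<close>

definition topologically_equivalent ::
  "('a::real_normed_vector \<Rightarrow> 'a) \<Rightarrow> 'a set \<Rightarrow> ('b::real_normed_vector \<Rightarrow> 'b) \<Rightarrow> 'b set \<Rightarrow> bool"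
  where
  "topologically_equivalent F S G T \<longleftrightarrow>
     (\<exists>H K. homeomorphism S T H K \<and>
        (\<forall>x\<in>S. H ` orbit F S x = orbit G T (H x)) \<and>
        (\<forall>I \<gamma>. maximal_solution F S I \<gamma> \<longrightarrow>
           (\<exists>J \<sigma> \<tau>. maximal_solution G T J \<sigma> \<and>
              continuous_on I \<tau> \<and> strict_mono_on I \<tau> \<and> \<tau> ` I = J \<and>
              (\<forall>t\<in>I. H (\<gamma> t) = \<sigma> (\<tau> t)))))"

section \<open>The reduced smoothed problem\<close>

text \<open>
  Points are triples \<^term>\<open>(r, v, u)\<close>. The case distinctions on \<^term>\<open>\<delta> = 0\<close> only
  matter at \<^term>\<open>r = 0\<close>, where the quotients would be \<^term>\<open>0 / 0 = 0\<close>.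
\<close>

definition reduced_field ::
  "real \<Rightarrow> real \<Rightarrow> real \<times> real \<times> real \<Rightarrow> real \<times> real \<times> real" where
  "reduced_field \<alpha> \<delta> = (\<lambda>(r, v, u).
     (r * v,
      u\<^sup>2 + \<alpha> / 2 * v\<^sup>2 -
        (if \<delta> = 0 then \<alpha>
         else \<alpha> * r powr (\<alpha> + 2) / (r\<^sup>2 + \<delta>\<^sup>2) powr (\<alpha> / 2 + 1)),
      (\<alpha> - 2) / 2 * u * v))"

definition energy_surface :: "real \<Rightarrow> real \<Rightarrow> real \<Rightarrow> (real \<times> real \<times> real) set" where
  "energy_surface \<alpha> h \<delta> = {(r, v, u). r \<ge> 0 \<and>
     u\<^sup>2 + v\<^sup>2 =
       (if \<delta> = 0 then 2 else 2 * r powr \<alpha> / (r\<^sup>2 + \<delta>\<^sup>2) powr (\<alpha> / 2))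
       - 2 * r powr \<alpha> * \<bar>h\<bar>}"

definition noncollision_surface :: "real \<Rightarrow> real \<Rightarrow> real \<Rightarrow> (real \<times> real \<times> real) set" where
  "noncollision_surface \<alpha> h \<delta> = {(r, v, u) \<in> energy_surface \<alpha> h \<delta>. r > 0 \<and> u \<noteq> 0}"

end

theory Submission
  imports Defs
begin

text \<open>
  In the variables \<open>s = r\<^sup>2\<close>, \<open>w = v r\<^bsup>1 - \<alpha>/2\<^esup>\<close> and the angular momentum \<open>c = u r\<^bsup>1 - \<alpha>/2\<^esup>\<close> the energy relation
  is \<open>w\<^sup>2 + c\<^sup>2 = W s\<close> with \<open>W\<close> strictly concave, positive between two zeros, both for \<open>\<delta> = 0\<close> and for
  \<open>\<delta> = \<epsilon>\<close>. Writing \<open>W s = \<rho>\<^sup>2 - x\<^sup>2\<close> with a \<open>C\<^sup>1\<close> coordinate \<open>x\<close> identifies the phase space with the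
  sphere \<open>x\<^sup>2 + w\<^sup>2 + c\<^sup>2 = \<rho>\<^sup>2\<close> minus its equator \<open>c = 0\<close>, and the equation with
  \<open>x' = \<Omega> w\<close>, \<open>w' = - \<Omega> x\<close>, \<open>c' = 0\<close> for a continuous \<open>\<Omega> > 0\<close> depending on \<open>x\<close>. The orbits are
  therefore the parallels, all run through in the same sense, with the two poles as fixed points, and
  rescaling one sphere to the other is a topological equivalence.
\<close>

section \<open>Autonomous equations\<close>

text \<open>On a compact subinterval around \<open>t\<close> the candidate differs from an integral
  with fixed lower limit by a constant, so the fundamental theorem of calculus applies
  there.\<close>

lemma antiderivative_open_interval:
  fixes f :: "real \<Rightarrow> real"
  assumes "open I" "is_interval I" "continuous_on I f"
  obtains F where "\<And>t. t \<in> I \<Longrightarrow> (F has_real_derivative f t) (at t)"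
proof (cases "I = {}")
  case True
  then show ?thesis using that by blast
next
  case False
  then obtain t0 where t0: "t0 \<in> I" by blast
  \<comment> \<open>Oriented integral from \<open>t0\<close> to \<open>t\<close>: one of the two
    intervals is empty or a single point, so its integral vanishes.\<close>
  define F where "F = (\<lambda>t. integral {t0..t} f - integral {t..t0} f)"
  have "(F has_real_derivative f t) (at t)" if t: "t \<in> I" for t
  proof -
    have mM: "min t t0 \<in> I" "max t t0 \<in> I" using t t0 by (auto simp: min_def max_def)
    obtain c where c: "c < min t t0" "c \<in> I"
    proof -
      obtain e where "e > 0" "ball (min t t0) e \<subseteq> I" using assms(1) mM(1) openE by blast
      then have "min t t0 - e/2 \<in> I" by (intro subsetD[of _ I]) (auto simp: dist_real_def)
      then show ?thesis using that[of "min t t0 - e/2"] \<open>e > 0\<close> by linarith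
    qed
    obtain d where d: "d > max t t0" "d \<in> I"
    proof -
      obtain e where "e > 0" "ball (max t t0) e \<subseteq> I" using assms(1) mM(2) openE by blast
      then have "max t t0 + e/2 \<in> I" by (intro subsetD[of _ I]) (auto simp: dist_real_def)
      then show ?thesis using that[of "max t t0 + e/2"] \<open>e > 0\<close> by linarith
    qed
    have sub: "{c..d} \<subseteq> I" using assms(2) c(2) d(2) unfolding is_interval_1 by (meson atLeastAtMost_iff subsetI)
    have cont: "continuous_on {c..d} f" using continuous_on_subset[OF assms(3) sub] .
    have int: "f integrable_on {x..y}" if "c \<le> x" "y \<le> d" for x y
      by (rule integrable_continuous_real, rule continuous_on_subset[OF cont]) (use that in auto)
    have Feq: "F u = integral {c..u} f - integral {c..t0} f" if u: "u \<in> {c<..<d}" for u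
    proof (cases "t0 \<le> u")
      case True
      have z: "integral {u..t0} f = 0"
        using True by (cases "u = t0") auto
      have "integral {c..t0} f + integral {t0..u} f = integral {c..u} f"
        by (rule Henstock_Kurzweil_Integration.integral_combine) (use True c u int in auto)
      then show ?thesis using z by (simp add: F_def)
    next
      case False
      have "integral {c..u} f + integral {u..t0} f = integral {c..t0} f"
        by (rule Henstock_Kurzweil_Integration.integral_combine) (use False c d u int in auto)
      then show ?thesis using False by (simp add: F_def)
    qed
    have tcd: "t \<in> {c<..<d}" using c d by auto
    have "((\<lambda>u. integral {c..u} f) has_real_derivative f t) (at t within {c..d})"
      by (rule integral_has_real_derivative[OF cont]) (use tcd in auto)
    then have "((\<lambda>u. integral {c..u} f) has_real_derivative f t) (at t)"
      using tcd by (simp add: at_within_Icc_at)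
    then have "((\<lambda>u. integral {c..u} f - integral {c..t0} f) has_real_derivative f t) (at t)"
      by (auto intro!: derivative_eq_intros)
    then show ?thesis
      by (rule has_field_derivative_transform_within_open[of _ _ _ "{c<..<d}"]) (use tcd Feq in auto)
  qed
  then show ?thesis using that by blast
qed

lemma zero_derivative_constant:
  fixes f :: "real \<Rightarrow> real"
  assumes "is_interval I" "\<And>t. t \<in> I \<Longrightarrow> (f has_real_derivative 0) (at t)" "s \<in> I" "t \<in> I"
  shows "f s = f t"
proof -
  have "\<exists>c. \<forall>x\<in>I. f x = c"
    by (rule has_field_derivative_zero_constant)
       (use assms in \<open>auto simp: is_interval_convex_1 intro: has_field_derivative_at_within\<close>)
  then show ?thesis using assms by auto
qed

text \<open>Integrating factor: \<open>y * exp (- A)\<close> is constant for an antiderivative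
  \<open>A\<close> of \<open>a\<close>, and the exponential does not affect the sign.\<close>

lemma linear_scalar_equation_same_sign:
  fixes a y :: "real \<Rightarrow> real"
  assumes "open I" "is_interval I" "continuous_on I a"
    and y: "\<And>t. t \<in> I \<Longrightarrow> (y has_real_derivative a t * y t) (at t)"
    and "s \<in> I" "t \<in> I"
  shows "sgn (y t) = sgn (y s)"
proof -
  obtain A where A: "\<And>t. t \<in> I \<Longrightarrow> (A has_real_derivative a t) (at t)"
    using antiderivative_open_interval[OF assms(1-3)] by blast
  have "y t * exp (- A t) = y s * exp (- A s)"
    by (rule zero_derivative_constant[OF assms(2) _ \<open>t \<in> I\<close> \<open>s \<in> I\<close>])
       (auto intro!: derivative_eq_intros y A)
  then have "sgn (y t * exp (- A t)) = sgn (y s * exp (- A s))" by simp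
  then show ?thesis by (simp add: sgn_mult)
qed

text \<open>
  Separation of variables: with \<^term>\<open>G' = 1 / f\<close> the solutions of \<^term>\<open>\<phi>' = f \<phi>\<close> are exactly
  the translates of the inverse function of \<^term>\<open>G\<close>, so no Lipschitz condition is needed.
\<close>

lemma periodic_scalar_equation:
  fixes f :: "real \<Rightarrow> real"
  assumes cont: "continuous_on UNIV f" and pos: "\<And>x. 0 < f x"
    and per: "\<And>x. f (x + p) = f x" and p: "0 < p"
  obtains \<phi> T where "0 < T" "strict_mono \<phi>" "surj \<phi>"
    "\<And>t. (\<phi> has_real_derivative f (\<phi> t)) (at t)"
    "\<And>t. \<phi> (t + T) = \<phi> t + p"
    "\<And>I \<psi>. is_interval I \<Longrightarrow> (\<And>t. t \<in> I \<Longrightarrow> (\<psi> has_real_derivative f (\<psi> t)) (at t)) \<Longrightarrow>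
       \<exists>d. \<forall>t\<in>I. \<psi> t = \<phi> (t + d)"
proof -
  have "continuous_on UNIV (\<lambda>x. 1 / f x)"
    by (intro continuous_intros cont) (metis pos less_irrefl)
  then obtain G where G: "\<And>x. (G has_real_derivative 1 / f x) (at x)"
    using antiderivative_open_interval[of UNIV "\<lambda>x. 1 / f x"] by auto
  have mono: "strict_mono G"
  proof (rule strict_monoI)
    fix x y :: real assume "x < y"
    then show "G x < G y"
      by (rule DERIV_pos_imp_increasing) (use G pos in \<open>auto intro!: exI\<close>)
  qed
  define T where "T = G p - G 0"
  have "0 < T" using strict_monoD[OF mono p] by (simp add: T_def)
  have Gp: "G (x + p) = G x + T" for x
  proof -
    \<comment> \<open>Periodicity of \<open>f\<close> makes the two derivatives cancel, so crossing
      one period always takes the same time \<open>T\<close>.\<close>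
    have "((\<lambda>x. G (x + p) - G x) has_real_derivative 0) (at x)" for x
      using DERIV_shift[of G "1 / f x" x p] G[of "x + p"] G[of x] per[of x]
      by (auto intro!: derivative_eq_intros)
    then have "G (x + p) - G x = G (0 + p) - G 0"
      by (intro zero_derivative_constant[of UNIV "\<lambda>x. G (x + p) - G x"]) auto
    then show ?thesis by (simp add: T_def)
  qed
  \<comment> \<open>Together with \<open>Gm\<close> this makes \<open>G\<close> unbounded in both
    directions. Hence \<open>G\<close> is onto and its inverse is defined for all times.\<close>
  have Gn: "G (real n * p) = G 0 + real n * T" for n
    by (induction n) (use Gp in \<open>auto simp: algebra_simps\<close>, metis add.commute)
  have Gm: "G (- (real n * p)) = G 0 - real n * T" for n
  proof (induction n)
    case (Suc n)
    have "G (- (real (Suc n) * p)) + T = G (- (real n * p))"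
      using Gp[of "- (real (Suc n) * p)"] by (simp add: algebra_simps)
    then show ?case using Suc by (simp add: algebra_simps)
  qed auto
  have contG: "isCont G x" for x using G DERIV_isCont by blast
  have "\<exists>x. G x = y" for y
  proof -
    obtain n where n: "\<bar>y - G 0\<bar> < real n * T"
      using ex_less_of_nat_mult[OF \<open>0 < T\<close>] by blast
    have "\<exists>x\<ge>- (real n * p). x \<le> real n * p \<and> G x = y"
      by (rule IVT) (use n Gn Gm contG p in auto)
    then show ?thesis by blast
  qed
  then have "surj G" by (metis surjI)
  define \<phi> where "\<phi> = inv G"
  have G\<phi>: "G (\<phi> t) = t" for t using \<open>surj G\<close> by (simp add: \<phi>_def surj_f_inv_f)
  have \<phi>G: "\<phi> (G x) = x" for x
    using strict_mono_imp_inj_on[OF mono] by (simp add: \<phi>_def)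
  have smono: "strict_mono \<phi>"
    by (rule strict_monoI) (metis G\<phi> mono strict_mono_less)
  have "surj \<phi>" by (metis \<phi>G surjI)
  have "isCont \<phi> (G x)" for x
    by (rule isCont_inverse_function[where d = 1]) (use \<phi>G contG in auto)
  then have cont\<phi>: "isCont \<phi> t" for t by (metis G\<phi>)
  have der: "(\<phi> has_real_derivative f (\<phi> t)) (at t)" for t
  proof -
    have "(\<phi> has_real_derivative inverse (1 / f (\<phi> t))) (at t)"
      by (rule DERIV_inverse_function[where f = G and a = "t - 1" and b = "t + 1"])
         (use G pos[of "\<phi> t"] G\<phi> cont\<phi> in auto)
    then show ?thesis by simp
  qed
  have "\<phi> (t + T) = \<phi> t + p" for t
    by (metis G\<phi> Gp \<phi>G)
  moreover have "\<exists>d. \<forall>t\<in>I. \<psi> t = \<phi> (t + d)"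
    if I: "is_interval I" and \<psi>: "\<And>t. t \<in> I \<Longrightarrow> (\<psi> has_real_derivative f (\<psi> t)) (at t)" for I \<psi>
  proof (cases "I = {}")
    case False
    then obtain t0 where t0: "t0 \<in> I" by blast
    \<comment> \<open>Uniqueness: along any solution \<open>G\<close> grows at unit rate, which
      fixes the solution up to a time shift.\<close>
    have "G (\<psi> t) - t = G (\<psi> t0) - t0" if "t \<in> I" for t
    proof (rule zero_derivative_constant[OF I _ that t0])
      fix s assume "s \<in> I"
      show "((\<lambda>t. G (\<psi> t) - t) has_real_derivative 0) (at s)"
        using DERIV_chain2[OF G \<psi>[OF \<open>s \<in> I\<close>]] pos[of "\<psi> s"]
        by (auto intro!: derivative_eq_intros)
    qed
    then have "\<forall>t\<in>I. \<psi> t = \<phi> (t + (G (\<psi> t0) - t0))"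
      by (metis \<phi>G add.commute diff_add_cancel)
    then show ?thesis by blast
  qed auto
  ultimately show ?thesis using that[OF \<open>0 < T\<close> smono \<open>surj \<phi>\<close> der] by blast
qed

section \<open>Time shifts and equilibria of general autonomous equations\<close>

lemma solution_on_translate:
  assumes "solution_on F S UNIV \<gamma>"
  shows "solution_on F S UNIV (\<lambda>t. \<gamma> (t + d))"
  unfolding solution_on_def
proof (intro conjI ballI)
  fix t
  have "\<gamma> (t + d) \<in> S" "(\<gamma> has_vector_derivative F (\<gamma> (t + d))) (at (t + d))"
    using assms by (auto simp: solution_on_def)
  then show "\<gamma> (t + d) \<in> S" by simp
  have "(\<gamma> \<circ> (\<lambda>t. t + d) has_vector_derivative 1 *\<^sub>R F (\<gamma> (t + d))) (at t)"
    by (rule vector_diff_chain_at)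
       (use \<open>(\<gamma> has_vector_derivative _) _\<close> in \<open>auto intro!: derivative_eq_intros\<close>)
  then show "((\<lambda>t. \<gamma> (t + d)) has_vector_derivative F (\<gamma> (t + d))) (at t)"
    by (simp add: o_def)
qed auto

text \<open>A singleton orbit is nonempty, so some solution passes through \<open>x\<close>; it is
  constant near time 0, and its derivative there is both zero and \<open>G x\<close>.\<close>

lemma fixed_point_imp_zero:
  assumes "fixed_point G T x"
  shows "G x = 0"
proof -
  have "orbit G T x = {x}" using assms by (simp add: fixed_point_def)
  then obtain \<gamma> I where \<gamma>: "solution_on G T I \<gamma>" "0 \<in> I" "\<gamma> 0 = x"
    unfolding orbit_def by (auto simp: set_eq_iff)
  have const: "\<gamma> t = x" if "t \<in> I" for t
  proof -
    have "\<gamma> t \<in> orbit G T x" unfolding orbit_def using \<gamma> that by blast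
    then show ?thesis using \<open>orbit G T x = {x}\<close> by simp
  qed
  have "open I" "(\<gamma> has_vector_derivative G x) (at 0)"
    using \<gamma> by (auto simp: solution_on_def)
  then have "((\<lambda>_. x) has_vector_derivative G x) (at 0)"
    by (intro has_vector_derivative_transform_within_open[OF _ _ \<gamma>(2) const])
  then show ?thesis
    by (rule vector_derivative_unique_at[OF _ has_vector_derivative_const])
qed

section \<open>Rotations of a punctured sphere\<close>

definition punctured_sphere :: "real \<Rightarrow> (real \<times> real \<times> real) set" where
  "punctured_sphere \<rho> = {(x, w, c). x\<^sup>2 + w\<^sup>2 + c\<^sup>2 = \<rho>\<^sup>2 \<and> c \<noteq> 0}"

definition rotation_field :: "(real \<Rightarrow> real) \<Rightarrow> real \<times> real \<times> real \<Rightarrow> real \<times> real \<times> real" where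
  "rotation_field \<Omega> = (\<lambda>(x, w, c). (\<Omega> x * w, - (\<Omega> x * x), 0))"

text \<open>The angle is measured from the \<open>w\<close>-axis towards the \<open>x\<close>-axis,
  so that it increases along \<open>rotation_field\<close> when \<open>\<Omega>\<close> is
  positive.\<close>

definition parallel :: "real \<Rightarrow> real \<Rightarrow> real \<Rightarrow> real \<times> real \<times> real" where
  "parallel R c \<theta> = (R * sin \<theta>, R * cos \<theta>, c)"

lemma has_vector_derivative_triple_iff:
  fixes f g h :: "real \<Rightarrow> real"
  shows "((\<lambda>t. (f t, g t, h t)) has_vector_derivative (a, b, c)) (at t) \<longleftrightarrow>
    (f has_real_derivative a) (at t) \<and> (g has_real_derivative b) (at t) \<and>
    (h has_real_derivative c) (at t)"
proof
  assume *: "((\<lambda>t. (f t, g t, h t)) has_vector_derivative (a, b, c)) (at t)"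
  note 1 = bounded_linear.has_vector_derivative[OF bounded_linear_fst *]
    and 2 = bounded_linear.has_vector_derivative[OF bounded_linear_snd *]
  note 3 = bounded_linear.has_vector_derivative[OF bounded_linear_fst 2]
    and 4 = bounded_linear.has_vector_derivative[OF bounded_linear_snd 2]
  then show "(f has_real_derivative a) (at t) \<and> (g has_real_derivative b) (at t) \<and>
    (h has_real_derivative c) (at t)"
    using 1 3 4 by (simp add: has_real_derivative_iff_has_vector_derivative)
qed (auto simp: has_real_derivative_iff_has_vector_derivative intro!: has_vector_derivative_Pair)

lemma in_punctured_sphere_parallel:
  assumes "z \<in> punctured_sphere \<rho>"
  obtains R c \<theta> where "0 \<le> R" "c \<noteq> 0" "R\<^sup>2 + c\<^sup>2 = \<rho>\<^sup>2" "z = parallel R c \<theta>"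
proof -
  obtain x w c where z: "z = (x, w, c)" by (cases z)
  then have c: "x\<^sup>2 + w\<^sup>2 + c\<^sup>2 = \<rho>\<^sup>2" "c \<noteq> 0" using assms by (auto simp: punctured_sphere_def)
  define R where "R = sqrt (x\<^sup>2 + w\<^sup>2)"
  have R: "0 \<le> R" "R\<^sup>2 = x\<^sup>2 + w\<^sup>2" by (auto simp: R_def)
  show ?thesis
  proof (cases "R = 0")
    case True
    then show ?thesis using that[of 0 c 0] z c R by (auto simp: parallel_def)
  next
    case False
    have "(w / R)\<^sup>2 + (x / R)\<^sup>2 = R\<^sup>2 / R\<^sup>2"
      unfolding R by (simp only: power_divide add_divide_distrib[symmetric] add.commute R(2))
    then have "(w / R)\<^sup>2 + (x / R)\<^sup>2 = 1" using False by simp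
    then obtain \<theta> where "w / R = cos \<theta>" "x / R = sin \<theta>" using sincos_total_2pi by metis
    then have "z = parallel R c \<theta>" using False z by (auto simp: parallel_def field_simps)
    then show ?thesis using that[of R c \<theta>] c R by auto
  qed
qed

lemma parallel_in_punctured_sphere:
  assumes "c \<noteq> 0" "R\<^sup>2 + c\<^sup>2 = \<rho>\<^sup>2"
  shows "parallel R c \<theta> \<in> punctured_sphere \<rho>"
proof -
  have "(R * sin \<theta>)\<^sup>2 + (R * cos \<theta>)\<^sup>2 = R\<^sup>2 * ((sin \<theta>)\<^sup>2 + (cos \<theta>)\<^sup>2)"
    by (simp only: power_mult_distrib distrib_left)
  then show ?thesis using assms by (auto simp: punctured_sphere_def parallel_def)
qed

lemma punctured_sphere_fst_bound:
  assumes "(x, w, c) \<in> punctured_sphere \<rho>" "0 < \<rho>"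
  shows "x \<in> {-\<rho><..<\<rho>}"
proof -
  have "0 < c\<^sup>2" "x\<^sup>2 + w\<^sup>2 + c\<^sup>2 = \<rho>\<^sup>2" using assms by (auto simp: punctured_sphere_def)
  then have "x\<^sup>2 < \<rho>\<^sup>2" using zero_le_power2[of w] by linarith
  then have "\<bar>x\<bar> < \<rho>" using assms(2) power2_less_imp_less[of "\<bar>x\<bar>" \<rho>] by simp
  then show ?thesis by auto
qed

text \<open>The phase is the integral of \<open>\<Omega>\<close> along the given solution; undoing a
  rotation by this phase leaves constants. No Lipschitz condition on \<open>\<Omega>\<close> enters,
  and the poles \<open>R = 0\<close> need no separate treatment.\<close>

lemma rotation_solution_phase:
  assumes sol: "solution_on (rotation_field \<Omega>) (punctured_sphere \<rho>) I z"
    and cont: "continuous_on {-\<rho><..<\<rho>} \<Omega>" and \<rho>: "0 < \<rho>"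
    and t0: "t0 \<in> I" "z t0 = parallel R c \<theta>"
  obtains \<psi> where "\<And>t. t \<in> I \<Longrightarrow> z t = parallel R c (\<psi> t)"
    "\<And>t. t \<in> I \<Longrightarrow> (\<psi> has_real_derivative \<Omega> (R * sin (\<psi> t))) (at t)"
proof -
  define x w e where "x = fst \<circ> z" and "w = fst \<circ> snd \<circ> z" and "e = snd \<circ> snd \<circ> z"
  have z: "z = (\<lambda>t. (x t, w t, e t))" by (auto simp: x_def w_def e_def)
  have I: "open I" "is_interval I" using sol by (auto simp: solution_on_def)
  have der: "(x has_real_derivative \<Omega> (x t) * w t) (at t)"
    "(w has_real_derivative - (\<Omega> (x t) * x t)) (at t)" "(e has_real_derivative 0) (at t)"
    and mem: "z t \<in> punctured_sphere \<rho>" if "t \<in> I" for t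
    using sol that unfolding solution_on_def
    by (auto simp: z rotation_field_def has_vector_derivative_triple_iff)
  have xb: "x t \<in> {-\<rho><..<\<rho>}" if "t \<in> I" for t
    using punctured_sphere_fst_bound[OF _ \<rho>] mem[OF that] by (auto simp: z)
  have "continuous_on I x" using DERIV_isCont[OF der(1)] by (intro continuous_at_imp_continuous_on) blast
  then have "continuous_on I (\<lambda>t. \<Omega> (x t))"
    by (rule continuous_on_compose2[OF cont]) (use xb in auto)
  then obtain A where A: "\<And>t. t \<in> I \<Longrightarrow> (A has_real_derivative \<Omega> (x t)) (at t)"
    using antiderivative_open_interval[OF I] by blast
  define \<psi> where "\<psi> = (\<lambda>t. A t - A t0 + \<theta>)"
  have \<psi>: "(\<psi> has_real_derivative \<Omega> (x t)) (at t)" if "t \<in> I" for t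
    unfolding \<psi>_def by (auto intro!: derivative_eq_intros A that)
  have t0': "x t0 = R * sin \<theta>" "w t0 = R * cos \<theta>" "e t0 = c" "\<psi> t0 = \<theta>"
    using t0(2) by (auto simp: z parallel_def \<psi>_def)
  have eq: "x t = R * sin (\<psi> t) \<and> w t = R * cos (\<psi> t) \<and> e t = c" if "t \<in> I" for t
  proof -
    \<comment> \<open>This and the next quantity are the coordinates of \<open>(x, w)\<close> in the
      frame turning with \<open>\<psi>\<close>. Both are conserved and keep their initial values 0
      and \<open>R\<close>; inverting the rotation then recovers \<open>x\<close> and
      \<open>w\<close>.\<close>
    have "x t * cos (\<psi> t) - w t * sin (\<psi> t) = x t0 * cos (\<psi> t0) - w t0 * sin (\<psi> t0)"
      by (rule zero_derivative_constant[OF I(2) _ that t0(1)])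
         (auto intro!: derivative_eq_intros der \<psi> simp: algebra_simps)
    then have a: "x t * cos (\<psi> t) - w t * sin (\<psi> t) = 0" by (simp add: t0')
    have "x t * sin (\<psi> t) + w t * cos (\<psi> t) = x t0 * sin (\<psi> t0) + w t0 * cos (\<psi> t0)"
      by (rule zero_derivative_constant[OF I(2) _ that t0(1)])
         (auto intro!: derivative_eq_intros der \<psi> simp: algebra_simps)
    also have "\<dots> = R * ((sin \<theta>)\<^sup>2 + (cos \<theta>)\<^sup>2)"
      by (simp only: t0' power2_eq_square distrib_left mult.assoc)
    finally have b: "x t * sin (\<psi> t) + w t * cos (\<psi> t) = R" by simp
    have sc: "(sin (\<psi> t))\<^sup>2 + (cos (\<psi> t))\<^sup>2 = 1" by simp
    have "x t = R * sin (\<psi> t)" "w t = R * cos (\<psi> t)" using a b sc by algebra+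
    moreover have "e t = c"
      using zero_derivative_constant[OF I(2) der(3) that t0(1)] t0' by simp
    ultimately show ?thesis by simp
  qed
  show ?thesis
  proof (rule that)
    show "z t = parallel R c (\<psi> t)" if "t \<in> I" for t
      using eq[OF that] by (simp add: z parallel_def)
    show "(\<psi> has_real_derivative \<Omega> (R * sin (\<psi> t))) (at t)" if "t \<in> I" for t
      using eq[OF that] \<psi>[OF that] by simp
  qed
qed

lemma rotation_solution_of_phase:
  assumes "c \<noteq> 0" "R\<^sup>2 + c\<^sup>2 = \<rho>\<^sup>2"
    and "\<And>t. (\<phi> has_real_derivative \<Omega> (R * sin (\<phi> t))) (at t)"
  shows "solution_on (rotation_field \<Omega>) (punctured_sphere \<rho>) UNIV (\<lambda>t. parallel R c (\<phi> t))"
  using assms parallel_in_punctured_sphere[OF assms(1,2)]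
  by (auto simp: solution_on_def rotation_field_def parallel_def has_vector_derivative_triple_iff
      intro!: derivative_eq_intros)

section \<open>Flows conjugate to a rotation\<close>

text \<open>The conjugacy is recorded as a homeomorphism that transports solutions both ways on the
  same time interval. Derivatives of the maps themselves are not mentioned.\<close>

locale rotation_conjugate =
  fixes F :: "'a::real_normed_vector \<Rightarrow> 'a" and N :: "'a set"
    and \<Phi> :: "'a \<Rightarrow> real \<times> real \<times> real" and \<Psi> :: "real \<times> real \<times> real \<Rightarrow> 'a"
    and \<rho> :: real and \<Omega> :: "real \<Rightarrow> real"
  assumes \<rho>_pos: "0 < \<rho>"
    and \<Omega>_cont: "continuous_on {-\<rho><..<\<rho>} \<Omega>"
    and \<Omega>_pos: "x \<in> {-\<rho><..<\<rho>} \<Longrightarrow> 0 < \<Omega> x"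
    and homeo: "homeomorphism N (punctured_sphere \<rho>) \<Phi> \<Psi>"
    and push: "solution_on F N I \<gamma> \<Longrightarrow>
      solution_on (rotation_field \<Omega>) (punctured_sphere \<rho>) I (\<lambda>t. \<Phi> (\<gamma> t))"
    and pull: "solution_on (rotation_field \<Omega>) (punctured_sphere \<rho>) I z \<Longrightarrow>
      solution_on F N I (\<lambda>t. \<Psi> (z t))"
begin

lemma \<Psi>_in: "z \<in> punctured_sphere \<rho> \<Longrightarrow> \<Psi> z \<in> N"
  and \<Phi>_in: "x \<in> N \<Longrightarrow> \<Phi> x \<in> punctured_sphere \<rho>"
  and \<Psi>\<Phi>: "x \<in> N \<Longrightarrow> \<Psi> (\<Phi> x) = x"
  and \<Phi>\<Psi>: "z \<in> punctured_sphere \<rho> \<Longrightarrow> \<Phi> (\<Psi> z) = z"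
  using homeo by (auto simp: homeomorphism_def)

lemma point_cases:
  assumes "x \<in> N"
  obtains R c \<theta> where "0 \<le> R" "c \<noteq> 0" "R\<^sup>2 + c\<^sup>2 = \<rho>\<^sup>2" "x = \<Psi> (parallel R c \<theta>)"
  using in_punctured_sphere_parallel[OF \<Phi>_in[OF assms]] \<Psi>\<Phi>[OF assms] by metis

text \<open>\<open>\<phi>\<close> is the phase as a function of time along one parallel, and
  \<open>T\<close> the time of a full turn. The last clause is uniqueness: every solution meeting
  the parallel is a time shift of the standard one. For \<open>R = 0\<close> the phase still runs
  although the point stands still.\<close>

definition clock :: "real \<Rightarrow> real \<Rightarrow> (real \<Rightarrow> real) \<Rightarrow> real \<Rightarrow> bool" where
  "clock R c \<phi> T \<longleftrightarrow> 0 < T \<and> strict_mono \<phi> \<and> surj \<phi> \<and> continuous_on UNIV \<phi> \<and>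
     (\<forall>t. \<phi> (t + T) = \<phi> t + 2 * pi) \<and>
     solution_on F N UNIV (\<lambda>t. \<Psi> (parallel R c (\<phi> t))) \<and>
     (\<forall>I \<gamma> t0 \<theta>. solution_on F N I \<gamma> \<and> t0 \<in> I \<and> \<gamma> t0 = \<Psi> (parallel R c \<theta>) \<longrightarrow>
       (\<exists>d. \<forall>t\<in>I. \<gamma> t = \<Psi> (parallel R c (\<phi> (t + d)))))"

lemma clockD:
  assumes "clock R c \<phi> T"
  shows "0 < T" "strict_mono \<phi>" "surj \<phi>" "continuous_on UNIV \<phi>"
    "\<phi> (t + T) = \<phi> t + 2 * pi"
    "solution_on F N UNIV (\<lambda>t. \<Psi> (parallel R c (\<phi> t)))"
    "solution_on F N I \<gamma> \<Longrightarrow> t0 \<in> I \<Longrightarrow> \<gamma> t0 = \<Psi> (parallel R c \<theta>) \<Longrightarrow>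
       \<exists>d. \<forall>t\<in>I. \<gamma> t = \<Psi> (parallel R c (\<phi> (t + d)))"
  using assms unfolding clock_def by blast+

text \<open>On a fixed parallel the angular speed \<open>\<Omega> (R * sin \<theta>)\<close> is
  positive and periodic in the angle, so the motion reduces to
  \<open>periodic_scalar_equation\<close>.\<close>

lemma ex_clock:
  assumes c: "c \<noteq> 0" "R\<^sup>2 + c\<^sup>2 = \<rho>\<^sup>2"
  shows "\<exists>\<phi> T. clock R c \<phi> T"
proof -
  have sph: "parallel R c \<theta> \<in> punctured_sphere \<rho>" for \<theta>
    using parallel_in_punctured_sphere[OF c] .
  have b: "R * sin \<theta> \<in> {-\<rho><..<\<rho>}" for \<theta>
    using punctured_sphere_fst_bound[OF sph[of \<theta>, unfolded parallel_def] \<rho>_pos] .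
  have cont: "continuous_on UNIV (\<lambda>\<theta>. \<Omega> (R * sin \<theta>))"
    by (rule continuous_on_compose2[OF \<Omega>_cont]) (use b in \<open>auto intro!: continuous_intros\<close>)
  obtain \<phi> T where \<phi>: "0 < T" "strict_mono \<phi>" "surj \<phi>"
    "\<And>t. (\<phi> has_real_derivative \<Omega> (R * sin (\<phi> t))) (at t)"
    "\<And>t. \<phi> (t + T) = \<phi> t + 2 * pi"
    "\<And>I \<psi>. is_interval I \<Longrightarrow>
       (\<And>t. t \<in> I \<Longrightarrow> (\<psi> has_real_derivative \<Omega> (R * sin (\<psi> t))) (at t)) \<Longrightarrow>
       \<exists>d. \<forall>t\<in>I. \<psi> t = \<phi> (t + d)"
    by (rule periodic_scalar_equation[OF cont \<Omega>_pos[OF b], of "2 * pi"]) auto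
  have "continuous_on UNIV \<phi>"
    using DERIV_isCont[OF \<phi>(4)] by (intro continuous_at_imp_continuous_on) blast
  moreover have "solution_on F N UNIV (\<lambda>t. \<Psi> (parallel R c (\<phi> t)))"
    by (rule pull, rule rotation_solution_of_phase[OF c \<phi>(4)])
  moreover have "\<exists>d. \<forall>t\<in>I. \<gamma> t = \<Psi> (parallel R c (\<phi> (t + d)))"
    if sol: "solution_on F N I \<gamma>" and t0: "t0 \<in> I" "\<gamma> t0 = \<Psi> (parallel R c \<theta>)" for I \<gamma> t0 \<theta>
  proof -
    have "\<Phi> (\<gamma> t0) = parallel R c \<theta>" using t0 \<Phi>\<Psi>[OF sph] by simp
    then obtain \<psi> where \<psi>: "\<And>t. t \<in> I \<Longrightarrow> \<Phi> (\<gamma> t) = parallel R c (\<psi> t)"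
      "\<And>t. t \<in> I \<Longrightarrow> (\<psi> has_real_derivative \<Omega> (R * sin (\<psi> t))) (at t)"
      using rotation_solution_phase[OF push[OF sol] \<Omega>_cont \<rho>_pos t0(1)] by metis
    have "is_interval I" using sol by (simp add: solution_on_def)
    from \<phi>(6)[OF this \<psi>(2)] obtain d where "\<forall>t\<in>I. \<psi> t = \<phi> (t + d)" by blast
    moreover have "\<gamma> t = \<Psi> (\<Phi> (\<gamma> t))" if "t \<in> I" for t
      using \<Psi>\<Phi> sol that by (simp add: solution_on_def)
    ultimately show ?thesis using \<psi>(1) by metis
  qed
  ultimately show ?thesis using \<phi>(1-3,5) unfolding clock_def by blast
qed

text \<open>Uniqueness keeps every solution on its parallel, and surjectivity of the phase makes the
  standard solution sweep all of it.\<close>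

lemma orbit_eq:
  assumes c: "c \<noteq> 0" "R\<^sup>2 + c\<^sup>2 = \<rho>\<^sup>2"
  shows "orbit F N (\<Psi> (parallel R c \<theta>)) = range (\<lambda>\<theta>. \<Psi> (parallel R c \<theta>))"
proof -
  obtain \<phi> T where "clock R c \<phi> T" using ex_clock[OF c] by blast
  note \<phi> = clockD[OF this]
  obtain s where s: "\<phi> s = \<theta>" using \<phi>(3) by (metis surjD)
  have shift: "solution_on F N UNIV (\<lambda>t. \<Psi> (parallel R c (\<phi> (t + s))))"
    using solution_on_translate[OF \<phi>(6), of s] by simp
  show ?thesis
  proof (intro equalityI subsetI)
    fix y assume "y \<in> orbit F N (\<Psi> (parallel R c \<theta>))"
    then obtain \<gamma> I t where "y = \<gamma> t" "solution_on F N I \<gamma>" "0 \<in> I"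
      "\<gamma> 0 = \<Psi> (parallel R c \<theta>)" "t \<in> I" unfolding orbit_def by blast
    then show "y \<in> range (\<lambda>\<theta>. \<Psi> (parallel R c \<theta>))" using \<phi>(7) by blast
  next
    fix y assume "y \<in> range (\<lambda>\<theta>. \<Psi> (parallel R c \<theta>))"
    then obtain \<theta>' where y: "y = \<Psi> (parallel R c \<theta>')" by blast
    obtain s' where "\<phi> s' = \<theta>'" using \<phi>(3) by (metis surjD)
    then have "y = \<Psi> (parallel R c (\<phi> ((s' - s) + s)))" using y by simp
    then show "y \<in> orbit F N (\<Psi> (parallel R c \<theta>))"
      unfolding orbit_def using shift s
      by (intro CollectI exI[of _ "\<lambda>t. \<Psi> (parallel R c (\<phi> (t + s)))"] exI[of _ UNIV]
          exI[of _ "s' - s"]) simp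
  qed
qed

lemma orbit_pole:
  assumes "c \<noteq> 0" "c\<^sup>2 = \<rho>\<^sup>2"
  shows "orbit F N (\<Psi> (0, 0, c)) = {\<Psi> (0, 0, c)}"
  using orbit_eq[of c 0 0] assms by (auto simp: parallel_def)

lemma periodic_orbit_parallel:
  assumes c: "c \<noteq> 0" "R\<^sup>2 + c\<^sup>2 = \<rho>\<^sup>2" and "R \<noteq> 0"
  shows "periodic_orbit F N (orbit F N (\<Psi> (parallel R c \<theta>)))"
proof -
  obtain \<phi> T where "clock R c \<phi> T" using ex_clock[OF c] by blast
  note \<phi> = clockD[OF this]
  obtain s t where st: "\<phi> s = 0" "\<phi> t = pi" using \<phi>(3) by (metis surjD)
  \<comment> \<open>Antipodal points of a parallel of nonzero radius differ, so the solution is not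
    constant.\<close>
  have "\<Psi> (parallel R c 0) \<noteq> \<Psi> (parallel R c pi)"
  proof
    assume "\<Psi> (parallel R c 0) = \<Psi> (parallel R c pi)"
    then have "parallel R c 0 = parallel R c pi"
      using \<Phi>\<Psi> parallel_in_punctured_sphere[OF c] by metis
    then show False using \<open>R \<noteq> 0\<close> by (simp add: parallel_def)
  qed
  then have "\<Psi> (parallel R c (\<phi> s)) \<noteq> \<Psi> (parallel R c (\<phi> t))" using st by simp
  moreover have "range (\<lambda>\<theta>. \<Psi> (parallel R c \<theta>)) = range (\<lambda>t. \<Psi> (parallel R c (\<phi> t)))"
    using image_image[of "\<lambda>\<theta>. \<Psi> (parallel R c \<theta>)" \<phi> UNIV] \<phi>(3) by simp
  moreover have "parallel R c (\<theta> + 2 * pi) = parallel R c \<theta>" for \<theta>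
    by (simp add: parallel_def)
  ultimately show ?thesis
    unfolding periodic_orbit_def orbit_eq[OF c] using \<phi>(1,5,6)
    by (intro exI[of _ "\<lambda>t. \<Psi> (parallel R c (\<phi> t))"] exI[of _ T]) auto
qed

end

lemma homeomorphism_scale_punctured_sphere:
  assumes "0 < \<rho>" "0 < \<rho>'"
  shows "homeomorphism (punctured_sphere \<rho>) (punctured_sphere \<rho>')
    ((*\<^sub>R) (\<rho>' / \<rho>)) ((*\<^sub>R) (\<rho> / \<rho>'))"
proof -
  have *: "(b / a) *\<^sub>R z \<in> punctured_sphere b"
    if "0 < a" "0 < b" "z \<in> punctured_sphere a" for a b z
  proof -
    obtain x w c where z: "z = (x, w, c)" by (cases z)
    have "(b / a * x)\<^sup>2 + (b / a * w)\<^sup>2 + (b / a * c)\<^sup>2 = (b / a)\<^sup>2 * (x\<^sup>2 + w\<^sup>2 + c\<^sup>2)"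
      by (simp only: power_mult_distrib distrib_left)
    also have "\<dots> = b\<^sup>2"
      using that by (simp add: z punctured_sphere_def power_divide)
    finally show ?thesis using that by (simp add: z punctured_sphere_def)
  qed
  show ?thesis
    by (rule homeomorphismI) (use assms * in \<open>auto intro!: continuous_intros\<close>)
qed

text \<open>Scaling the spheres maps parallels to parallels and keeps the angle. Orbits therefore
  correspond, and matching the two increasing phases gives the time change.\<close>

lemma topologically_equivalent_rotation_conjugates:
  assumes 1: "rotation_conjugate F N \<Phi> \<Psi> \<rho> \<Omega>" and 2: "rotation_conjugate F' N' \<Phi>' \<Psi>' \<rho>' \<Omega>'"
  shows "topologically_equivalent F N F' N'"
proof -
  interpret A: rotation_conjugate F N \<Phi> \<Psi> \<rho> \<Omega> by fact
  interpret B: rotation_conjugate F' N' \<Phi>' \<Psi>' \<rho>' \<Omega>' by fact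
  define k where "k = \<rho>' / \<rho>"
  have k: "0 < k" "k * \<rho> = \<rho>'" using A.\<rho>_pos B.\<rho>_pos by (auto simp: k_def)
  define H where "H = \<Psi>' \<circ> ((*\<^sub>R) k \<circ> \<Phi>)"
  define K where "K = (\<Psi> \<circ> (*\<^sub>R) (\<rho> / \<rho>')) \<circ> \<Phi>'"
  have "homeomorphism N N' H K"
    unfolding H_def K_def k_def
    by (intro homeomorphism_compose[OF homeomorphism_compose[OF A.homeo]
          homeomorphism_symD[OF B.homeo]] homeomorphism_scale_punctured_sphere A.\<rho>_pos B.\<rho>_pos)
  have c': "k * c \<noteq> 0" "(k * R)\<^sup>2 + (k * c)\<^sup>2 = \<rho>'\<^sup>2"
    if c: "c \<noteq> 0" "R\<^sup>2 + c\<^sup>2 = \<rho>\<^sup>2" for R c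
    using that k by (auto simp: power_mult_distrib distrib_left[symmetric] simp flip: k(2))
  have H: "H (\<Psi> (parallel R c \<theta>)) = \<Psi>' (parallel (k * R) (k * c) \<theta>)"
    if c: "c \<noteq> 0" "R\<^sup>2 + c\<^sup>2 = \<rho>\<^sup>2" for R c \<theta>
    using A.\<Phi>\<Psi>[OF parallel_in_punctured_sphere[OF c]] by (simp add: H_def parallel_def mult.assoc)
  have orb: "H ` orbit F N x = orbit F' N' (H x)" if x: "x \<in> N" for x
  proof -
    obtain R c \<theta> where c: "c \<noteq> 0" "R\<^sup>2 + c\<^sup>2 = \<rho>\<^sup>2" and x: "x = \<Psi> (parallel R c \<theta>)"
      using A.point_cases[OF x] by metis
    show ?thesis
      by (simp add: x H[OF c] A.orbit_eq[OF c] B.orbit_eq[OF c'[OF c]] image_image)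
  qed
  have "\<exists>J \<sigma> \<tau>. maximal_solution F' N' J \<sigma> \<and> continuous_on I \<tau> \<and> strict_mono_on I \<tau> \<and>
      \<tau> ` I = J \<and> (\<forall>t\<in>I. H (\<gamma> t) = \<sigma> (\<tau> t))" if max: "maximal_solution F N I \<gamma>" for I \<gamma>
  proof -
    have sol: "solution_on F N I \<gamma>" using max by (simp add: maximal_solution_def)
    then obtain t0 where t0: "t0 \<in> I" "\<gamma> t0 \<in> N" by (auto simp: solution_on_def)
    obtain R c \<theta> where c: "c \<noteq> 0" "R\<^sup>2 + c\<^sup>2 = \<rho>\<^sup>2" and \<theta>: "\<gamma> t0 = \<Psi> (parallel R c \<theta>)"
      using A.point_cases[OF t0(2)] by metis
    obtain \<phi> T where "A.clock R c \<phi> T" using A.ex_clock[OF c] by blast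
    note \<phi> = A.clockD[OF this]
    obtain \<psi> T' where "B.clock (k * R) (k * c) \<psi> T'" using B.ex_clock[OF c'[OF c]] by blast
    note \<psi> = B.clockD[OF this]
    obtain d where d: "\<forall>t\<in>I. \<gamma> t = \<Psi> (parallel R c (\<phi> (t + d)))"
      using \<phi>(7)[OF sol t0(1) \<theta>] by blast
    have shift: "solution_on F N UNIV (\<lambda>t. \<Psi> (parallel R c (\<phi> (t + d))))"
      using solution_on_translate[OF \<phi>(6), of d] by simp
    \<comment> \<open>The shifted standard solution extends \<open>\<gamma>\<close> to the whole
      line, so maximality forces \<open>I = UNIV\<close>.\<close>
    have "solution_on F N J \<sigma> \<Longrightarrow> I \<subseteq> J \<Longrightarrow> \<forall>t\<in>I. \<sigma> t = \<gamma> t \<Longrightarrow> J = I" for J \<sigma>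
      using max unfolding maximal_solution_def by blast
    from this[OF shift] have I: "I = UNIV" using d by simp
    have inj: "inj \<psi>" using \<psi>(2) by (rule strict_mono_imp_inj_on)
    \<comment> \<open>\<open>\<tau> t\<close> is the time at which the target solution has the same
      phase as the source solution at time \<open>t\<close>.\<close>
    define \<tau> where "\<tau> = (\<lambda>t. inv \<psi> (\<phi> (t + d)))"
    have \<psi>\<tau>: "\<psi> (\<tau> t) = \<phi> (t + d)" for t using \<psi>(3) by (simp add: \<tau>_def surj_f_inv_f)
    have "strict_mono \<tau>"
    proof (rule strict_monoI)
      fix s t :: real assume "s < t"
      then have "\<psi> (\<tau> s) < \<psi> (\<tau> t)" unfolding \<psi>\<tau> using \<phi>(2) by (simp add: strict_mono_less)
      then show "\<tau> s < \<tau> t" using \<psi>(2) by (simp add: strict_mono_less)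
    qed
    moreover have "surj \<tau>"
    proof (rule surjI)
      fix y
      have "\<phi> (inv \<phi> (\<psi> y) - d + d) = \<psi> y" using \<phi>(3) by (simp add: surj_f_inv_f)
      then show "\<tau> (inv \<phi> (\<psi> y) - d) = y" using inj by (simp add: \<tau>_def)
    qed
    moreover have "continuous_on UNIV \<tau>"
    proof -
      have "isCont (inv \<psi>) (\<psi> x)" for x
        by (rule isCont_inverse_function[where d = 1])
           (use inj \<psi>(4) in \<open>auto simp: continuous_on_eq_continuous_at\<close>)
      then have "continuous_on UNIV (inv \<psi>)"
        using \<psi>(3) by (metis continuous_at_imp_continuous_on surjD)
      then show ?thesis unfolding \<tau>_def
        by (rule continuous_on_compose2)
           (auto intro!: continuous_on_compose2[OF \<phi>(4)] continuous_intros)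
    qed
    moreover have "maximal_solution F' N' UNIV (\<lambda>t. \<Psi>' (parallel (k * R) (k * c) (\<psi> t)))"
      using \<psi>(6) by (auto simp: maximal_solution_def)
    moreover have "H (\<gamma> t) = \<Psi>' (parallel (k * R) (k * c) (\<psi> (\<tau> t)))" for t
      using d H[OF c] by (simp add: I \<psi>\<tau>)
    ultimately show ?thesis
      by (intro exI[of _ UNIV] exI[of _ "\<lambda>t. \<Psi>' (parallel (k * R) (k * c) (\<psi> t))"] exI[of _ \<tau>])
         (auto simp: I)
  qed
  then show ?thesis
    unfolding topologically_equivalent_def using \<open>homeomorphism N N' H K\<close> orb by blast
qed

section \<open>Unimodal functions as parabolas\<close>

text \<open>
  The signed root \<open>X\<close> of \<^term>\<open>W m - W s\<close> is a \<open>C\<^sup>1\<close> coordinate with nowhere vanishing derivative, also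
  at the maximum: \<^term>\<open>X s / (s - m)\<close> and \<^term>\<open>X' s\<close> both tend to \<^term>\<open>sqrt (k / 2)\<close>, since
  \<^term>\<open>- k\<close> is the second derivative of \<^term>\<open>W\<close> there.
\<close>

locale unimodal =
  fixes W W' :: "real \<Rightarrow> real" and m b k :: real
  assumes m: "0 < m" "m < b"
    and cont: "continuous_on {0..b} W" and zero: "W 0 = 0" "W b = 0"
    and deriv: "\<And>s. 0 < s \<Longrightarrow> s < b \<Longrightarrow> (W has_real_derivative W' s) (at s)"
    and cont': "continuous_on {0<..<b} W'"
    and W'_pos: "\<And>s. 0 < s \<Longrightarrow> s < m \<Longrightarrow> 0 < W' s"
    and W'_neg: "\<And>s. m < s \<Longrightarrow> s < b \<Longrightarrow> W' s < 0"
    and W'_zero: "W' m = 0"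
    and deriv2: "(W' has_real_derivative - k) (at m)" and k: "0 < k"
begin

definition \<rho> :: real where "\<rho> = sqrt (W m)"

definition X :: "real \<Rightarrow> real" where
  "X s = (if s \<le> m then - sqrt (W m - W s) else sqrt (W m - W s))"

definition X' :: "real \<Rightarrow> real" where
  "X' s = (if s = m then sqrt (k / 2) else - W' s / (2 * X s))"

definition S :: "real \<Rightarrow> real" where "S = inv_into {0..b} X"

section \<open>Monotonicity of \<open>W\<close> and the signed root as a bijection of
  intervals\<close>

lemma W_increasing:
  assumes "0 \<le> s" "s < t" "t \<le> m"
  shows "W s < W t"
proof (rule DERIV_pos_imp_increasing_open[OF assms(2)])
  show "\<exists>y. (W has_real_derivative y) (at x) \<and> 0 < y" if "s < x" "x < t" for x
    using deriv[of x] W'_pos[of x] that assms m by auto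
  show "continuous_on {s..t} W" using assms m by (intro continuous_on_subset[OF cont]) auto
qed

lemma W_decreasing:
  assumes "m \<le> s" "s < t" "t \<le> b"
  shows "W t < W s"
proof (rule DERIV_neg_imp_decreasing_open[OF assms(2)])
  show "\<exists>y. (W has_real_derivative y) (at x) \<and> y < 0" if "s < x" "x < t" for x
    using deriv[of x] W'_neg[of x] that assms m by auto
  show "continuous_on {s..t} W" using assms m by (intro continuous_on_subset[OF cont]) auto
qed

lemma W_less_max: "0 \<le> s \<Longrightarrow> s \<le> b \<Longrightarrow> s \<noteq> m \<Longrightarrow> W s < W m"
  using W_increasing[of s m] W_decreasing[of m s] by (cases "s < m") auto

lemma W_le_max: "0 \<le> s \<Longrightarrow> s \<le> b \<Longrightarrow> W s \<le> W m"
  using W_less_max[of s] by (cases "s = m") auto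

lemma \<rho>: "0 < \<rho>" "\<rho>\<^sup>2 = W m"
  using W_increasing[of 0 m] m zero by (auto simp: \<rho>_def)

lemma X_square: "0 \<le> s \<Longrightarrow> s \<le> b \<Longrightarrow> (X s)\<^sup>2 = \<rho>\<^sup>2 - W s"
  using W_le_max[of s] by (auto simp: X_def \<rho>)

lemma X_neg: "0 \<le> s \<Longrightarrow> s < m \<Longrightarrow> X s < 0"
  and X_pos: "m < s \<Longrightarrow> s \<le> b \<Longrightarrow> 0 < X s"
  and X_m [simp]: "X m = 0"
  using W_less_max[of s] m by (auto simp: X_def)

lemma X_ends: "X 0 = - \<rho>" "X b = \<rho>"
  using m zero by (auto simp: X_def \<rho>_def)

lemma X_strict_mono: "strict_mono_on {0..b} X"
proof (rule strict_mono_onI)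
  fix s t assume st: "s \<in> {0..b}" "t \<in> {0..b}" "s < t"
  consider "t \<le> m" | "m \<le> s" | "s < m" "m < t" by linarith
  then show "X s < X t"
  proof cases
    case 1
    then show ?thesis using W_increasing[of s t] st by (simp add: X_def)
  next
    case 2
    then have "X t = sqrt (W m - W t)" "X s = sqrt (W m - W s)" using st by (auto simp: X_def)
    then show ?thesis using W_decreasing[of s t] st 2 by simp
  next
    case 3
    then show ?thesis using X_neg[of s] X_pos[of t] st by auto
  qed
qed

lemma X_inj: "inj_on X {0..b}"
  using X_strict_mono by (rule strict_mono_on_imp_inj_on)

lemma X_cont: "continuous_on {0..b} X"
proof -
  have "continuous_on ({0..m} \<union> {m..b}) (\<lambda>s. if s \<le> m then - sqrt (W m - W s) else sqrt (W m - W s))"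
    by (rule continuous_on_If)
       (use m in \<open>auto intro!: continuous_intros continuous_on_subset[OF cont]\<close>)
  moreover have "{0..m} \<union> {m..b} = {0..b}" using m by auto
  ultimately show ?thesis unfolding X_def by simp
qed

lemma X_image: "X ` {0..b} = {-\<rho>..\<rho>}"
proof (intro equalityI subsetI)
  fix x assume "x \<in> X ` {0..b}"
  then obtain s where s: "s \<in> {0..b}" "x = X s" by blast
  have "mono_on {0..b} X" using X_strict_mono by (rule strict_mono_on_imp_mono_on)
  then have "X 0 \<le> X s" "X s \<le> X b" using s m by (auto simp: mono_on_def)
  then show "x \<in> {-\<rho>..\<rho>}" using s X_ends by auto
next
  fix x assume "x \<in> {-\<rho>..\<rho>}"
  then have "\<exists>s\<ge>0. s \<le> b \<and> X s = x"
    by (intro IVT') (use m X_cont X_ends in auto)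
  then show "x \<in> X ` {0..b}" by force
qed

lemma S_X: "s \<in> {0..b} \<Longrightarrow> S (X s) = s"
  using X_inj by (simp add: S_def)

lemma X_S: "x \<in> {-\<rho>..\<rho>} \<Longrightarrow> X (S x) = x"
  unfolding S_def by (rule f_inv_into_f) (simp add: X_image)

lemma X_in: "0 < s \<Longrightarrow> s < b \<Longrightarrow> X s \<in> {-\<rho><..<\<rho>}"
  using strict_mono_onD[OF X_strict_mono, of 0 s] strict_mono_onD[OF X_strict_mono, of s b] X_ends
  by auto

lemma S_in: "x \<in> {-\<rho><..<\<rho>} \<Longrightarrow> S x \<in> {0<..<b}"
proof -
  assume x: "x \<in> {-\<rho><..<\<rho>}"
  then have "S x \<in> {0..b}" unfolding S_def by (intro inv_into_into) (simp add: X_image)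
  moreover have "S x \<noteq> 0" "S x \<noteq> b" using X_S[of x] x X_ends by auto
  ultimately show ?thesis by auto
qed

lemma S_cont: "continuous_on {-\<rho>..\<rho>} S"
  using continuous_on_inv[OF X_cont compact_Icc, of S] S_X by (simp add: X_image)

text \<open>L'Hopital's rule gives \<open>(W m - W s) / (s - m)\<^sup>2\<close> the limit
  \<open>k / 2\<close>. Since \<open>X s\<close> has the sign of \<open>s - m\<close>, the quotient
  is the nonnegative square root of this expression. As \<open>X m = 0\<close>, the limit is also
  the derivative of \<open>X\<close> at \<open>m\<close>.\<close>

lemma X_quotient_at_max: "((\<lambda>s. X s / (s - m)) \<longlongrightarrow> sqrt (k / 2)) (at m)"
proof -
  have near: "eventually (\<lambda>s. s \<in> {0<..<b} - {m}) (at m)"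
    using m by (intro eventually_at_in_open) auto
  have quo: "((\<lambda>s. W' s / (s - m)) \<longlongrightarrow> - k) (at m)"
    using deriv2 W'_zero by (simp add: has_field_derivative_iff)
  have "isCont W m" using deriv[of m] m DERIV_isCont by blast
  then have W0: "((\<lambda>s. W m - W s) \<longlongrightarrow> 0) (at m)"
    by (auto intro!: tendsto_eq_intros simp: isCont_def)
  have "((\<lambda>s. (W m - W s) / (s - m)\<^sup>2) \<longlongrightarrow> k / 2) (at m)"
  proof (rule lhopital[OF W0, where f' = "\<lambda>s. - W' s" and g' = "\<lambda>s. 2 * (s - m)"])
    show "((\<lambda>s. (s - m)\<^sup>2) \<longlongrightarrow> 0) (at m)" by (auto intro!: tendsto_eq_intros)
    show "eventually (\<lambda>s. (s - m)\<^sup>2 \<noteq> 0) (at m)" "eventually (\<lambda>s. 2 * (s - m) \<noteq> 0) (at m)"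
      using near by (auto elim!: eventually_mono)
    show "eventually (\<lambda>s. ((\<lambda>s. W m - W s) has_real_derivative - W' s) (at s)) (at m)"
      using near by (rule eventually_mono) (auto intro!: derivative_eq_intros deriv)
    show "eventually (\<lambda>s. ((\<lambda>s. (s - m)\<^sup>2) has_real_derivative 2 * (s - m)) (at s)) (at m)"
      by (rule always_eventually) (auto intro!: derivative_eq_intros)
    have "((\<lambda>s. - (W' s / (s - m)) / 2) \<longlongrightarrow> - (- k) / 2) (at m)"
      by (intro tendsto_intros quo) auto
    then show "((\<lambda>s. - W' s / (2 * (s - m))) \<longlongrightarrow> k / 2) (at m)"
      by (simp add: mult.commute)
  qed
  then have "((\<lambda>s. sqrt ((W m - W s) / (s - m)\<^sup>2)) \<longlongrightarrow> sqrt (k / 2)) (at m)"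
    by (rule tendsto_real_sqrt)
  moreover have "eventually (\<lambda>s. sqrt ((W m - W s) / (s - m)\<^sup>2) = X s / (s - m)) (at m)"
    using near by (rule eventually_mono) (auto simp: real_sqrt_divide X_def minus_divide_right)
  ultimately show ?thesis by (rule Lim_transform_eventually)
qed

lemma X_deriv:
  assumes "0 < s" "s < b"
  shows "(X has_real_derivative X' s) (at s)"
proof -
  consider "s < m" | "s = m" | "m < s" by linarith
  then show ?thesis
  proof cases
    case 1
    have "((\<lambda>s. - sqrt (W m - W s)) has_real_derivative X' s) (at s)"
      using W_less_max[of s] assms 1 X_neg[of s]
      by (auto intro!: derivative_eq_intros deriv simp: X'_def X_def field_simps)
    then show ?thesis
      by (rule has_field_derivative_transform_within_open[of _ _ _ "{..<m}"])
         (use 1 in \<open>auto simp: X_def\<close>)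
  next
    case 2
    then show ?thesis using X_quotient_at_max by (simp add: has_field_derivative_iff X'_def)
  next
    case 3
    have "((\<lambda>s. sqrt (W m - W s)) has_real_derivative X' s) (at s)"
      using W_less_max[of s] assms 3 X_pos[of s]
      by (auto intro!: derivative_eq_intros deriv simp: X'_def X_def field_simps)
    then show ?thesis
      by (rule has_field_derivative_transform_within_open[of _ _ _ "{m<..}"])
         (use 3 in \<open>auto simp: X_def\<close>)
  qed
qed

lemma X'_pos:
  assumes "0 < s" "s < b"
  shows "0 < X' s"
proof -
  consider "s < m" | "s = m" | "m < s" by linarith
  then show ?thesis
    using assms X_neg[of s] X_pos[of s] W'_pos[of s] W'_neg[of s] k
    by cases (auto simp: X'_def zero_less_divide_iff divide_less_0_iff mult_less_0_iff)
qed

text \<open>The derivative of \<open>X_square\<close>; at \<open>m\<close> both sides vanish. This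
  identity turns the force \<open>W'\<close> into a multiple of the coordinate \<open>X\<close>, as
  a rotation requires.\<close>

lemma X_X': "0 < s \<Longrightarrow> s < b \<Longrightarrow> 2 * X s * X' s = - W' s"
  using X_neg[of s] X_pos[of s] W'_zero by (cases s m rule: linorder_cases) (auto simp: X'_def)

text \<open>Away from \<open>m\<close> the defining quotient is continuous. At \<open>m\<close> its
  numerator and denominator are both divided by \<open>s - m\<close>, and the limits
  \<open>- k\<close> and \<open>sqrt (k / 2)\<close> combine to the prescribed value.\<close>

lemma X'_cont: "continuous_on {0<..<b} X'"
proof (rule continuous_at_imp_continuous_on, rule ballI)
  fix s assume s: "s \<in> {0<..<b}"
  show "isCont X' s"
  proof (cases "s = m")
    case False
    have "isCont W' s" using cont' s by (simp add: continuous_on_eq_continuous_at)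
    moreover have "isCont X s" using X_deriv s DERIV_isCont by auto
    moreover have "X s \<noteq> 0"
      using X_neg[of s] X_pos[of s] s False by (cases s m rule: linorder_cases) auto
    ultimately have "isCont (\<lambda>s. - W' s / (2 * X s)) s" by (intro continuous_intros) auto
    moreover have "eventually (\<lambda>t. X' t = - W' t / (2 * X t)) (nhds s)"
      using t1_space_nhds[OF False] by (rule eventually_mono) (simp add: X'_def)
    ultimately show ?thesis using isCont_cong by fast
  next
    case True
    have quo: "((\<lambda>s. W' s / (s - m)) \<longlongrightarrow> - k) (at m)"
      using deriv2 W'_zero by (simp add: has_field_derivative_iff)
    have "((\<lambda>s. - (W' s / (s - m)) / (2 * (X s / (s - m)))) \<longlongrightarrow> - (- k) / (2 * sqrt (k / 2))) (at m)"
      by (intro tendsto_intros quo X_quotient_at_max) (use k in auto)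
    moreover have "- (- k) / (2 * sqrt (k / 2)) = sqrt (k / 2)"
    proof -
      have "sqrt (k / 2) * sqrt (k / 2) = k / 2" using k by simp
      then show ?thesis using k by (simp add: field_simps del: real_sqrt_mult_self)
    qed
    moreover have "eventually (\<lambda>s. - (W' s / (s - m)) / (2 * (X s / (s - m))) = X' s) (at m)"
      by (auto simp: eventually_at_filter X'_def)
    ultimately have "(X' \<longlongrightarrow> sqrt (k / 2)) (at m)"
      using Lim_transform_eventually by fastforce
    then show ?thesis by (simp add: isCont_def True X'_def)
  qed
qed

lemma S_deriv:
  assumes x: "x \<in> {-\<rho><..<\<rho>}"
  shows "(S has_real_derivative 1 / X' (S x)) (at x)"
proof -
  have s: "0 < S x" "S x < b" using S_in[OF x] by auto
  have "isCont S x"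
    using continuous_on_interior[OF S_cont] x by simp
  then have "(S has_real_derivative inverse (X' (S x))) (at x)"
    by (intro DERIV_inverse_function[where f = X and a = "-\<rho>" and b = \<rho>])
       (use x X_deriv[OF s] X'_pos[OF s] X_S in auto)
  then show ?thesis by (simp add: inverse_eq_divide)
qed

end

section \<open>The reduced smoothed problem\<close>

text \<open>Here \<open>l\<close> is the logarithmic derivative of \<open>r\<close>; the form fits
  the equation \<open>r' = r v\<close>.\<close>

lemma has_real_derivative_powr_logarithmic:
  fixes r :: "real \<Rightarrow> real"
  assumes "(r has_real_derivative r t * l) (at t)" "0 < r t"
  shows "((\<lambda>t. r t powr q) has_real_derivative q * l * r t powr q) (at t)"
proof -
  have "((\<lambda>t. r t powr q) has_real_derivative q * r t powr (q - 1) * (r t * l)) (at t)"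
    using DERIV_fun_powr[OF assms] by simp
  moreover have "q * r t powr (q - 1) * (r t * l) = q * l * r t powr q"
    using assms(2) by (simp add: powr_diff)
  ultimately show ?thesis by simp
qed

locale smoothed_problem =
  fixes \<alpha> h \<delta> :: real
  assumes \<alpha>: "0 < \<alpha>" "\<alpha> < 2" and h: "h < 0"
    and \<delta>: "0 \<le> \<delta>" "\<delta> < \<bar>h\<bar> powr (- 1 / \<alpha>)"
begin

text \<open>
  With \<open>s = r\<^sup>2\<close>, multiplying the energy relation by \<open>r\<^bsup>2 - \<alpha>\<^esup>\<close> turns it into \<open>w\<^sup>2 + c\<^sup>2 = W s\<close>, where
  \<open>w\<close> and \<open>c\<close> are \<open>v\<close> and \<open>u\<close> times \<open>r\<^bsup>1 - \<alpha>/2\<^esup>\<close>. The positive zero of \<open>W\<close> is \<open>b\<close>; the bound on \<^term>\<open>\<delta>\<close>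
  says exactly that \<open>b > 0\<close>.
\<close>

definition p :: real where "p = \<alpha> / 2"

definition a :: real where "a = \<delta>\<^sup>2"

definition b :: real where "b = \<bar>h\<bar> powr (- 1 / p) - a"

definition W :: "real \<Rightarrow> real" where
  "W s = 2 * s * (s + a) powr (- p) - 2 * \<bar>h\<bar> * s"

text \<open>The product rule leaves a term in \<open>s * (s + a) powr (- p - 1)\<close>; replacing
  \<open>s\<close> by \<open>(s + a) - a\<close> gives nonnegative coefficients to both powers, so
  that the monotonicity of each can be used.\<close>

definition W' :: "real \<Rightarrow> real" where
  "W' s = 2 * (1 - p) * (s + a) powr (- p) + 2 * p * a * (s + a) powr (- p - 1) - 2 * \<bar>h\<bar>"

text \<open>The critical point, which exists by Rolle's theorem and is unique because
  \<open>W'\<close> is strictly decreasing. It is the squared radius of the relative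
  equilibria.\<close>

definition m :: real where "m = (SOME s. 0 < s \<and> s < b \<and> W' s = 0)"

text \<open>Minus the second derivative of \<open>W\<close> at \<open>m\<close>.\<close>

definition k :: real where
  "k = 2 * (1 - p) * p * (m + a) powr (- p - 1) + 2 * p * a * (p + 1) * (m + a) powr (- p - 2)"

section \<open>The function \<open>W\<close>: zeros, strict concavity and critical point\<close>

lemma p: "0 < p" "p < 1" "\<alpha> = 2 * p"
  using \<alpha> by (auto simp: p_def)

lemma a: "0 \<le> a" by (simp add: a_def)

lemma b: "0 < b"
proof -
  have "\<delta>\<^sup>2 < (\<bar>h\<bar> powr (- 1 / \<alpha>))\<^sup>2" using \<delta> by (intro power_strict_mono) auto
  also have "\<dots> = \<bar>h\<bar> powr (- 1 / \<alpha>) * \<bar>h\<bar> powr (- 1 / \<alpha>)" by (simp add: power2_eq_square)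
  also have "\<dots> = \<bar>h\<bar> powr (- 1 / \<alpha> + - 1 / \<alpha>)" by (simp only: powr_add)
  also have "- 1 / \<alpha> + - 1 / \<alpha> = - 1 / p" using p by (simp add: field_simps)
  finally show ?thesis by (simp add: a_def b_def)
qed

lemma b_powr: "(b + a) powr (- p) = \<bar>h\<bar>"
  using p h by (simp add: b_def powr_powr)

lemma W_deriv: "0 < s \<Longrightarrow> (W has_real_derivative W' s) (at s)"
proof -
  assume s: "0 < s"
  have sa: "0 < s + a" using s a by simp
  have "(W has_real_derivative 2 * (s + a) powr (- p)
      + 2 * s * (- p * (s + a) powr (- p - 1)) - 2 * \<bar>h\<bar>) (at s)"
    unfolding W_def using DERIV_fun_powr[of "\<lambda>s. s + a" 1 s "- p"] sa
    by (auto intro!: derivative_eq_intros)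
  moreover have "(s + a) powr (- p) = (s + a) * (s + a) powr (- p - 1)"
    using sa by (simp add: powr_mult_base)
  ultimately show ?thesis by (simp add: W'_def algebra_simps)
qed

lemma W'_deriv: "0 < s \<Longrightarrow> (W' has_real_derivative
    - (2 * (1 - p) * p * (s + a) powr (- p - 1) + 2 * p * a * (p + 1) * (s + a) powr (- p - 2))) (at s)"
proof -
  assume s: "0 < s"
  have sa: "0 < s + a" using s a by simp
  show ?thesis
    unfolding W'_def
    using DERIV_fun_powr[of "\<lambda>s. s + a" 1 s "- p"] DERIV_fun_powr[of "\<lambda>s. s + a" 1 s "- p - 1"] sa
    by (auto intro!: derivative_eq_intros simp: algebra_simps)
qed

text \<open>Strictness comes from the first power, as \<open>0 < p < 1\<close>; the second one is
  only weakly decreasing since \<open>a\<close> may be 0.\<close>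

lemma W'_decreasing: "0 < s \<Longrightarrow> s < t \<Longrightarrow> W' t < W' s"
proof -
  assume st: "0 < s" "s < t"
  have "(t + a) powr (- p) < (s + a) powr (- p)"
    using st a p by (intro powr_less_mono2_neg) auto
  then have "2 * (1 - p) * (t + a) powr (- p) < 2 * (1 - p) * (s + a) powr (- p)"
    using p by (intro mult_strict_left_mono) auto
  moreover have "(t + a) powr (- p - 1) \<le> (s + a) powr (- p - 1)"
    using st a p by (intro powr_mono2') auto
  then have "2 * p * a * (t + a) powr (- p - 1) \<le> 2 * p * a * (s + a) powr (- p - 1)"
    using p a by (intro mult_left_mono) auto
  ultimately show ?thesis by (simp add: W'_def)
qed

lemma W_cont: "continuous_on {0..b} W"
proof (cases "a = 0")
  case True
  \<comment> \<open>For \<open>a = 0\<close> the negative power is singular at the origin; merging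
    it with the factor \<open>s\<close> leaves the positive exponent \<open>1 - p\<close>. At
    \<open>s = 0\<close> both forms give 0.\<close>
  have c: "continuous_on {0..b} (\<lambda>s. 2 * s powr (1 - p) - 2 * \<bar>h\<bar> * s)"
    using p by (intro continuous_intros continuous_on_powr') auto
  have "W s = 2 * s powr (1 - p) - 2 * \<bar>h\<bar> * s" if "s \<in> {0..b}" for s
    using that powr_mult_base[of s "- p"] by (cases "s = 0") (auto simp: W_def True)
  then show ?thesis by (intro continuous_on_eq[OF c]) simp
next
  case False
  then show ?thesis unfolding W_def using a
    by (intro continuous_intros) auto
qed

lemma W_ends: "W 0 = 0" "W b = 0"
  using b_powr by (auto simp: W_def)

lemma m_critical: "0 < m" "m < b" "W' m = 0"
proof -
  have "\<exists>s. 0 < s \<and> s < b \<and> (*) (W' s) = (\<lambda>v. 0)"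
    by (rule Rolle_deriv[OF b _ W_cont])
       (use W_ends W_deriv in \<open>auto simp: has_field_derivative_def\<close>)
  then have "\<exists>s. 0 < s \<and> s < b \<and> W' s = 0" by (metis mult.right_neutral)
  from someI_ex[OF this] show "0 < m" "m < b" "W' m = 0" by (auto simp: m_def)
qed

lemma k_pos: "0 < k"
  using p a m_critical unfolding k_def by (intro add_pos_nonneg mult_pos_pos mult_nonneg_nonneg) auto

sublocale unimodal W W' m b k
proof
  show "continuous_on {0<..<b} W'"
    using DERIV_isCont[OF W'_deriv] by (intro continuous_at_imp_continuous_on) auto
  show "0 < W' s" if "0 < s" "s < m" for s using W'_decreasing[OF that] m_critical by simp
  show "W' s < 0" if "m < s" "s < b" for s using W'_decreasing[OF _ that(1)] m_critical by simp
  show "(W' has_real_derivative - k) (at m)" using W'_deriv[OF m_critical(1)] by (simp add: k_def)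
qed (use m_critical W_cont W_ends W_deriv k_pos in auto)

text \<open>For \<open>s \<ge> b\<close> the factor \<open>(s + a) powr (- p)\<close> is at most its
  value \<open>\<bar>h\<bar>\<close> at \<open>b\<close>, which makes \<open>W s\<close>
  nonpositive. Nonzero angular momentum thus bounds the radius.\<close>

lemma W_pos_imp_less_b:
  assumes "0 < s" "0 < W s"
  shows "s < b"
proof (rule ccontr)
  assume "\<not> s < b"
  then have "(s + a) powr (- p) \<le> (b + a) powr (- p)"
    using p a b by (intro powr_mono2') auto
  then have "W s \<le> 0"
    using assms(1) mult_left_mono[of "(s + a) powr (- p)" "\<bar>h\<bar>" "2 * s"]
    by (simp add: W_def b_powr mult_ac)
  then show False using assms by simp
qed

section \<open>Energy relation and vector field expressed through \<open>W\<close>\<close>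

abbreviation F :: "real \<times> real \<times> real \<Rightarrow> real \<times> real \<times> real" where
  "F \<equiv> reduced_field \<alpha> \<delta>"

abbreviation E :: "(real \<times> real \<times> real) set" where "E \<equiv> energy_surface \<alpha> h \<delta>"

abbreviation N :: "(real \<times> real \<times> real) set" where "N \<equiv> noncollision_surface \<alpha> h \<delta>"

lemma square_powr: "0 < r \<Longrightarrow> (r\<^sup>2) powr q = r powr (2 * q)" for r q :: real
  by (simp add: powr_powr flip: powr_numeral)

lemma energy_surface_iff:
  assumes r: "0 < r"
  shows "(r, v, u) \<in> E \<longleftrightarrow> (u * r powr (1 - p))\<^sup>2 + (v * r powr (1 - p))\<^sup>2 = W (r\<^sup>2)"
proof -
  have e: "(r powr (1 - p))\<^sup>2 = r\<^sup>2 / r powr \<alpha>"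
  proof -
    have "(r powr (1 - p))\<^sup>2 = r powr (1 - p) * r powr (1 - p)" by (simp add: power2_eq_square)
    also have "\<dots> = r powr (2 - \<alpha>)" using p(3) by (simp flip: powr_add)
    finally show ?thesis using r by (simp add: powr_diff)
  qed
  \<comment> \<open>Both cases become one formula: for \<open>\<delta> = 0\<close> the powers of
    \<open>r\<close> cancel because \<open>r > 0\<close>.\<close>
  have z: "(if \<delta> = 0 then 2 else 2 * r powr \<alpha> / (r\<^sup>2 + \<delta>\<^sup>2) powr (\<alpha> / 2))
      = 2 * r powr \<alpha> * (r\<^sup>2 + a) powr (- p)"
    using r by (auto simp: a_def p_def powr_minus divide_simps square_powr)
  have "(r, v, u) \<in> E \<longleftrightarrow>
      u\<^sup>2 + v\<^sup>2 = 2 * r powr \<alpha> * (r\<^sup>2 + a) powr (- p) - 2 * r powr \<alpha> * \<bar>h\<bar>"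
    using r by (simp only: energy_surface_def z mem_Collect_eq case_prod_conv) simp
  also have "\<dots> \<longleftrightarrow> (u\<^sup>2 + v\<^sup>2) * (r\<^sup>2 / r powr \<alpha>) =
      (2 * r powr \<alpha> * (r\<^sup>2 + a) powr (- p) - 2 * r powr \<alpha> * \<bar>h\<bar>) * (r\<^sup>2 / r powr \<alpha>)"
    using r by (subst mult_right_cancel) auto
  also have "(2 * r powr \<alpha> * (r\<^sup>2 + a) powr (- p) - 2 * r powr \<alpha> * \<bar>h\<bar>) * (r\<^sup>2 / r powr \<alpha>) = W (r\<^sup>2)"
    using r by (simp add: W_def field_simps)
  also have "(u\<^sup>2 + v\<^sup>2) * (r\<^sup>2 / r powr \<alpha>) = (u * r powr (1 - p))\<^sup>2 + (v * r powr (1 - p))\<^sup>2"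
    by (simp only: power_mult_distrib e distrib_right)
  finally show ?thesis .
qed

text \<open>The energy relation eliminates \<open>u\<^sup>2\<close> from the equation for
  \<open>v\<close>; the terms depending only on \<open>r\<close> then collect into
  \<open>r powr \<alpha> * W' (r\<^sup>2)\<close>.\<close>

lemma reduced_field_eq:
  assumes r: "0 < r" and E: "(r, v, u) \<in> E"
  shows "F (r, v, u) = (r * v, r powr \<alpha> * W' (r\<^sup>2) - (1 - p) * v\<^sup>2, (p - 1) * u * v)"
proof -
  define Y where "Y = (r\<^sup>2 + a) powr (- p - 1)"
  have ra: "0 < r\<^sup>2 + a" using r a by (simp add: add_pos_nonneg)
  have Y: "(r\<^sup>2 + a) powr (- p) = (r\<^sup>2 + a) * Y"
    using ra by (simp add: Y_def powr_mult_base)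
  have z: "(if \<delta> = 0 then 2 else 2 * r powr \<alpha> / (r\<^sup>2 + \<delta>\<^sup>2) powr (\<alpha> / 2))
      = 2 * r powr \<alpha> * (r\<^sup>2 + a) powr (- p)"
    using r by (auto simp: a_def p_def powr_minus divide_simps square_powr)
  have uv: "u\<^sup>2 = 2 * r powr \<alpha> * ((r\<^sup>2 + a) * Y) - 2 * r powr \<alpha> * \<bar>h\<bar> - v\<^sup>2"
    using E r unfolding energy_surface_def by (simp only: z mem_Collect_eq case_prod_conv Y) simp
  \<comment> \<open>In the case \<open>\<delta> = 0\<close> the exponents
    \<open>\<alpha> + 2\<close> and \<open>2 * (- p - 1)\<close> add up to zero, which leaves the
    constant \<open>\<alpha>\<close>.\<close>
  have g: "(if \<delta> = 0 then \<alpha> else \<alpha> * r powr (\<alpha> + 2) / (r\<^sup>2 + \<delta>\<^sup>2) powr (\<alpha> / 2 + 1))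
      = \<alpha> * r powr (\<alpha> + 2) * Y"
  proof (cases "\<delta> = 0")
    case True
    have "a = 0" unfolding a_def by (simp add: True)
    then have "r powr (\<alpha> + 2) * Y = r powr (\<alpha> + 2) * (r\<^sup>2) powr (- p - 1)"
      by (simp add: Y_def)
    also have "\<dots> = r powr (\<alpha> + 2 + 2 * (- p - 1))"
      by (simp only: square_powr[OF r] powr_add)
    also have "\<dots> = 1" using p r by simp
    finally show ?thesis using True by simp
  next
    case False
    have "Y = 1 / (r\<^sup>2 + \<delta>\<^sup>2) powr (\<alpha> / 2 + 1)"
      using powr_minus_divide[of "r\<^sup>2 + a" "p + 1"] by (simp add: Y_def a_def p_def)
    then show ?thesis using False by simp
  qed
  have r2: "r powr (\<alpha> + 2) = r powr \<alpha> * r\<^sup>2" using r by (simp add: powr_add)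
  have w: "W' (r\<^sup>2) = 2 * (1 - p) * ((r\<^sup>2 + a) * Y) + 2 * p * a * Y - 2 * \<bar>h\<bar>"
    by (simp only: W'_def Y Y_def[symmetric])
  have "u\<^sup>2 + \<alpha> / 2 * v\<^sup>2 - \<alpha> * r powr (\<alpha> + 2) * Y = r powr \<alpha> * W' (r\<^sup>2) - (1 - p) * v\<^sup>2"
    unfolding uv r2 w p_def by (simp add: field_simps)
  moreover have "(\<alpha> - 2) / 2 * u * v = (p - 1) * u * v" by (simp add: p_def field_simps)
  ultimately show ?thesis by (simp only: reduced_field_def case_prod_conv g)
qed

lemma noncollision_iff:
  "(r, v, u) \<in> N \<longleftrightarrow> 0 < r \<and> u \<noteq> 0 \<and>
    (u * r powr (1 - p))\<^sup>2 + (v * r powr (1 - p))\<^sup>2 = W (r\<^sup>2)"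
  using energy_surface_iff by (auto simp: noncollision_surface_def)

lemma noncollision_less_b:
  assumes "(r, v, u) \<in> N"
  shows "0 < r\<^sup>2" "r\<^sup>2 < b"
proof -
  have *: "0 < r" "u \<noteq> 0" "(u * r powr (1 - p))\<^sup>2 + (v * r powr (1 - p))\<^sup>2 = W (r\<^sup>2)"
    using assms by (auto simp: noncollision_iff)
  then have "0 < (u * r powr (1 - p))\<^sup>2" by simp
  then have "0 < W (r\<^sup>2)" using * zero_le_power2[of "v * r powr (1 - p)"] by linarith
  then show "0 < r\<^sup>2" "r\<^sup>2 < b" using W_pos_imp_less_b[of "r\<^sup>2"] * by auto
qed

definition \<Phi> :: "real \<times> real \<times> real \<Rightarrow> real \<times> real \<times> real" where
  "\<Phi> z = (X ((fst z)\<^sup>2), fst (snd z) * fst z powr (1 - p), snd (snd z) * fst z powr (1 - p))"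

definition \<Psi> :: "real \<times> real \<times> real \<Rightarrow> real \<times> real \<times> real" where
  "\<Psi> z = (sqrt (S (fst z)), fst (snd z) * sqrt (S (fst z)) powr (p - 1),
          snd (snd z) * sqrt (S (fst z)) powr (p - 1))"

text \<open>Forced by \<open>x' = \<Omega> w\<close>: the chain rule for
  \<open>x = X (r\<^sup>2)\<close> gives \<open>X' (r\<^sup>2) * 2 * r\<^sup>2 * v\<close>, and
  \<open>v = w * r powr (p - 1)\<close>.\<close>

definition \<Omega> :: "real \<Rightarrow> real" where
  "\<Omega> x = 2 * X' (S x) * sqrt (S x) powr (1 + p)"

section \<open>The conjugacy between the noncollision surface and the punctured sphere\<close>

lemma powr_cancel: "0 < r \<Longrightarrow> r powr (1 - p) * r powr (p - 1) = 1" for r :: real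
  by (simp flip: powr_add)

lemma \<Phi>_in_sphere:
  assumes "(r, v, u) \<in> N"
  shows "\<Phi> (r, v, u) \<in> punctured_sphere \<rho>"
proof -
  have "(X (r\<^sup>2))\<^sup>2 = \<rho>\<^sup>2 - W (r\<^sup>2)" using noncollision_less_b[OF assms] by (intro X_square) auto
  then show ?thesis using assms by (simp add: \<Phi>_def punctured_sphere_def noncollision_iff)
qed

lemma S_sphere:
  assumes "(x, w, c) \<in> punctured_sphere \<rho>"
  shows "0 < S x" "S x < b" "X (S x) = x" "x \<in> {-\<rho><..<\<rho>}"
  using punctured_sphere_fst_bound[OF assms \<rho>(1)] S_in[of x] X_S[of x] by auto

lemma \<Psi>_in_noncollision:
  assumes "(x, w, c) \<in> punctured_sphere \<rho>"
  shows "\<Psi> (x, w, c) \<in> N"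
proof -
  note S = S_sphere[OF assms]
  define r where "r = sqrt (S x)"
  have r: "0 < r" "r\<^sup>2 = S x" using S by (auto simp: r_def)
  have 1: "y * r powr (p - 1) * r powr (1 - p) = y" for y
    using powr_cancel[OF r(1)] by (simp add: mult.assoc mult.commute)
  have "W (r\<^sup>2) = \<rho>\<^sup>2 - x\<^sup>2" using X_square[of "S x"] S r by simp
  then show ?thesis
    unfolding \<Psi>_def fst_conv snd_conv r_def[symmetric] noncollision_iff 1
    using assms r by (auto simp: punctured_sphere_def)
qed

lemma homeomorphism_\<Phi>_\<Psi>: "homeomorphism N (punctured_sphere \<rho>) \<Phi> \<Psi>"
proof (rule homeomorphismI)
  show "continuous_on N \<Phi>"
    unfolding \<Phi>_def
    by (intro continuous_intros continuous_on_compose2[OF X_cont])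
       (use noncollision_less_b in \<open>force simp: noncollision_surface_def less_imp_le\<close>)+
  have S: "0 < S (fst z)" "fst z \<in> {-\<rho>..\<rho>}" if "z \<in> punctured_sphere \<rho>" for z
    using S_sphere[of "fst z" "fst (snd z)" "snd (snd z)"] that by auto
  have "continuous_on (punctured_sphere \<rho>) (\<lambda>z. S (fst z))"
    by (rule continuous_on_compose2[OF S_cont]) (use S in \<open>auto intro!: continuous_intros\<close>)
  then show "continuous_on (punctured_sphere \<rho>) \<Psi>"
    unfolding \<Psi>_def by (intro continuous_intros) (use S in force)+
  show "\<Phi> ` N \<subseteq> punctured_sphere \<rho>" using \<Phi>_in_sphere by auto
  show "\<Psi> ` punctured_sphere \<rho> \<subseteq> N" using \<Psi>_in_noncollision by auto
  show "\<Psi> (\<Phi> z) = z" if z: "z \<in> N" for z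
  proof -
    obtain r v u where [simp]: "z = (r, v, u)" by (cases z)
    have r: "0 < r" using z by (simp add: noncollision_iff)
    have "S (X (r\<^sup>2)) = r\<^sup>2" using noncollision_less_b[of r v u] z by (intro S_X) auto
    then show ?thesis
      using r powr_cancel[OF r] by (simp add: \<Phi>_def \<Psi>_def mult.assoc)
  qed
  show "\<Phi> (\<Psi> z) = z" if z: "z \<in> punctured_sphere \<rho>" for z
  proof -
    obtain x w c where [simp]: "z = (x, w, c)" by (cases z)
    note S = S_sphere[of x w c]
    have "0 < sqrt (S x)" using S z by simp
    from powr_cancel[OF this] show ?thesis
      using S z by (simp add: \<Phi>_def \<Psi>_def mult.assoc mult.commute)
  qed
qed

text \<open>The equation for \<open>x\<close> holds by the choice of \<open>\<Omega>\<close>, and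
  the one for \<open>w\<close> by \<open>X_X'\<close>. The derivative of
  \<open>r powr (1 - p)\<close> cancels the term \<open>- (1 - p) * v\<^sup>2\<close> in
  \<open>v'\<close> and all of \<open>u'\<close>; the latter is conservation of angular
  momentum.\<close>

lemma solution_push:
  assumes sol: "solution_on F N I \<gamma>"
  shows "solution_on (rotation_field \<Omega>) (punctured_sphere \<rho>) I (\<lambda>t. \<Phi> (\<gamma> t))"
  unfolding solution_on_def
proof (intro conjI ballI)
  show "open I" "is_interval I" "I \<noteq> {}" using sol by (auto simp: solution_on_def)
  fix t assume t: "t \<in> I"
  define r v u where "r = fst \<circ> \<gamma>" and "v = fst \<circ> snd \<circ> \<gamma>" and "u = snd \<circ> snd \<circ> \<gamma>"
  have \<gamma>: "\<gamma> = (\<lambda>t. (r t, v t, u t))" by (auto simp: r_def v_def u_def)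
  have mem: "(r t, v t, u t) \<in> N" and der: "(\<gamma> has_vector_derivative F (\<gamma> t)) (at t)"
    using sol t by (auto simp: solution_on_def \<gamma>)
  show "\<Phi> (\<gamma> t) \<in> punctured_sphere \<rho>" using \<Phi>_in_sphere[OF mem] by (simp add: \<gamma>)
  have r: "0 < r t" and "(r t, v t, u t) \<in> E"
    using mem by (auto simp: noncollision_surface_def)
  note b = noncollision_less_b[OF mem]
  have S: "S (X ((r t)\<^sup>2)) = (r t)\<^sup>2" using b by (intro S_X) auto
  have dr: "(r has_real_derivative r t * v t) (at t)"
    and dv: "(v has_real_derivative r t powr \<alpha> * W' ((r t)\<^sup>2) - (1 - p) * (v t)\<^sup>2) (at t)"
    and du: "(u has_real_derivative (p - 1) * u t * v t) (at t)"
    using der unfolding \<gamma> reduced_field_eq[OF r \<open>(r t, v t, u t) \<in> E\<close>]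
    by (simp_all add: has_vector_derivative_triple_iff)
  have dq: "((\<lambda>t. r t powr (1 - p)) has_real_derivative (1 - p) * v t * r t powr (1 - p)) (at t)"
    by (rule has_real_derivative_powr_logarithmic[OF dr r])
  have \<Omega>: "\<Omega> (X ((r t)\<^sup>2)) = 2 * X' ((r t)\<^sup>2) * r t powr (1 + p)"
    using r by (simp add: \<Omega>_def S)
  have "((\<lambda>t. (r t)\<^sup>2) has_real_derivative 2 * r t * (r t * v t)) (at t)"
    by (auto intro!: derivative_eq_intros dr)
  from DERIV_chain2[OF X_deriv[OF b] this]
  have "((\<lambda>t. X ((r t)\<^sup>2)) has_real_derivative X' ((r t)\<^sup>2) * (2 * r t * (r t * v t))) (at t)" .
  moreover have "X' ((r t)\<^sup>2) * (2 * r t * (r t * v t)) =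
      \<Omega> (X ((r t)\<^sup>2)) * (v t * r t powr (1 - p))"
  proof -
    have "r t powr (1 + p) * r t powr (1 - p) = (r t)\<^sup>2" using r by (simp flip: powr_add)
    then have "\<Omega> (X ((r t)\<^sup>2)) * (v t * r t powr (1 - p)) = 2 * X' ((r t)\<^sup>2) * v t * (r t)\<^sup>2"
      unfolding \<Omega> by algebra
    then show ?thesis by (simp only: power2_eq_square mult_ac)
  qed
  moreover have "((\<lambda>t. v t * r t powr (1 - p)) has_real_derivative
      - (\<Omega> (X ((r t)\<^sup>2)) * X ((r t)\<^sup>2))) (at t)"
  proof -
    have "- (\<Omega> (X ((r t)\<^sup>2)) * X ((r t)\<^sup>2)) =
        - (2 * X ((r t)\<^sup>2) * X' ((r t)\<^sup>2)) * r t powr (1 + p)"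
      unfolding \<Omega> by (simp add: mult_ac)
    also have "\<dots> = W' ((r t)\<^sup>2) * r t powr (1 + p)" unfolding X_X'[OF b] by simp
    also have "1 + p = \<alpha> + (1 - p)" using p(3) by linarith
    also have "W' ((r t)\<^sup>2) * r t powr (\<alpha> + (1 - p)) =
        r t powr \<alpha> * W' ((r t)\<^sup>2) * r t powr (1 - p)"
      by (simp only: powr_add mult_ac)
    finally have "- (\<Omega> (X ((r t)\<^sup>2)) * X ((r t)\<^sup>2)) =
        r t powr \<alpha> * W' ((r t)\<^sup>2) * r t powr (1 - p)" .
    then show ?thesis
      using DERIV_mult[OF dv dq] by (simp add: algebra_simps power2_eq_square)
  qed
  moreover have "((\<lambda>t. u t * r t powr (1 - p)) has_real_derivative 0) (at t)"
    using DERIV_mult[OF du dq] by (simp add: algebra_simps)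
  ultimately show "((\<lambda>t. \<Phi> (\<gamma> t)) has_vector_derivative rotation_field \<Omega> (\<Phi> (\<gamma> t))) (at t)"
    by (simp add: \<gamma> \<Phi>_def rotation_field_def has_vector_derivative_triple_iff)
qed

text \<open>The derivative \<open>1 / X'\<close> of \<open>S\<close> cancels the factor
  \<open>X'\<close> of \<open>\<Omega>\<close>, which gives \<open>r' = r v\<close>. The equations
  for \<open>v\<close> and \<open>u\<close> then follow from the product rule with
  \<open>r powr (p - 1)\<close>.\<close>

lemma solution_pull:
  assumes sol: "solution_on (rotation_field \<Omega>) (punctured_sphere \<rho>) I z"
  shows "solution_on F N I (\<lambda>t. \<Psi> (z t))"
  unfolding solution_on_def
proof (intro conjI ballI)
  show "open I" "is_interval I" "I \<noteq> {}" using sol by (auto simp: solution_on_def)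
  fix t assume t: "t \<in> I"
  define x w c where "x = fst \<circ> z" and "w = fst \<circ> snd \<circ> z" and "c = snd \<circ> snd \<circ> z"
  have z: "z = (\<lambda>t. (x t, w t, c t))" by (auto simp: x_def w_def c_def)
  have mem: "(x t, w t, c t) \<in> punctured_sphere \<rho>"
    and dx: "(x has_real_derivative \<Omega> (x t) * w t) (at t)"
    and dw: "(w has_real_derivative - (\<Omega> (x t) * x t)) (at t)"
    and dc: "(c has_real_derivative 0) (at t)"
    using sol t by (auto simp: solution_on_def z rotation_field_def has_vector_derivative_triple_iff)
  show N: "\<Psi> (z t) \<in> N" using \<Psi>_in_noncollision[OF mem] by (simp add: z)
  note S = S_sphere[OF mem]
  define r where "r = (\<lambda>t. sqrt (S (x t)))"
  define v where "v = (\<lambda>t. w t * r t powr (p - 1))"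
  define u where "u = (\<lambda>t. c t * r t powr (p - 1))"
  have \<Psi>z: "\<Psi> (z t) = (r t, v t, u t)" for t by (simp add: \<Psi>_def z r_def v_def u_def)
  have r: "0 < r t" "(r t)\<^sup>2 = S (x t)" using S by (auto simp: r_def)
  have E: "(r t, v t, u t) \<in> E" using N by (simp add: \<Psi>z noncollision_surface_def)
  have rr: "r t powr (1 + p) = r t * (r t * r t powr (p - 1))"
    using r(1) by (simp add: powr_mult_base)
  have \<Omega>: "\<Omega> (x t) = 2 * X' (S (x t)) * r t powr (1 + p)" by (simp add: \<Omega>_def r_def)
  have "0 < X' (S (x t))" using X'_pos S by simp
  have "((\<lambda>t. S (x t)) has_real_derivative 1 / X' (S (x t)) * (\<Omega> (x t) * w t)) (at t)"
    by (rule DERIV_chain2[OF S_deriv[OF S(4)] dx])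
  then have "((\<lambda>t. S (x t)) has_real_derivative 2 * r t * (r t * v t)) (at t)"
    using \<open>0 < X' (S (x t))\<close> by (simp add: \<Omega> rr v_def mult_ac)
  from DERIV_chain2[OF DERIV_real_sqrt[OF S(1)] this]
  have dr: "(r has_real_derivative r t * v t) (at t)"
    using r(1) by (simp add: r_def divide_simps)
  have dq: "((\<lambda>t. r t powr (p - 1)) has_real_derivative (p - 1) * v t * r t powr (p - 1)) (at t)"
    by (rule has_real_derivative_powr_logarithmic[OF dr r(1)])
  have "(v has_real_derivative r t powr \<alpha> * W' ((r t)\<^sup>2) - (1 - p) * (v t)\<^sup>2) (at t)"
  proof -
    have "- (\<Omega> (x t) * x t) * r t powr (p - 1) =
        - (2 * X (S (x t)) * X' (S (x t))) * (r t powr (1 + p) * r t powr (p - 1))"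
      unfolding \<Omega> S(3) by (simp add: mult_ac)
    also have "r t powr (1 + p) * r t powr (p - 1) = r t powr \<alpha>"
      using p(3) by (simp flip: powr_add)
    finally have "- (\<Omega> (x t) * x t) * r t powr (p - 1) = r t powr \<alpha> * W' ((r t)\<^sup>2)"
      unfolding X_X'[OF S(1,2)] r(2) by simp
    then show ?thesis
      using DERIV_mult[OF dw dq] by (simp add: v_def algebra_simps power2_eq_square)
  qed
  moreover have "(u has_real_derivative (p - 1) * u t * v t) (at t)"
    using DERIV_mult[OF dc dq] by (simp add: u_def algebra_simps)
  ultimately show "((\<lambda>t. \<Psi> (z t)) has_vector_derivative F (\<Psi> (z t))) (at t)"
    using dr unfolding \<Psi>z reduced_field_eq[OF r(1) E] by (simp add: has_vector_derivative_triple_iff)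
qed

sublocale rotation_conjugate F N \<Phi> \<Psi> \<rho> \<Omega>
proof
  have "continuous_on {-\<rho><..<\<rho>} S" by (rule continuous_on_subset[OF S_cont]) auto
  then show "continuous_on {-\<rho><..<\<rho>} \<Omega>"
    unfolding \<Omega>_def
    by (intro continuous_intros continuous_on_compose2[OF X'_cont]) (use S_in in force)+
  show "0 < \<Omega> x" if "x \<in> {-\<rho><..<\<rho>}" for x
    using S_in[OF that] X'_pos by (simp add: \<Omega>_def)
qed (use \<rho> homeomorphism_\<Phi>_\<Psi> solution_push solution_pull in auto)

text \<open>Along a solution \<open>r\<close> and \<open>u\<close> satisfy linear scalar equations
  whose coefficients are continuous multiples of \<open>v\<close>, so neither can change sign or
  reach zero.\<close>

lemma solution_stays_noncollision:
  assumes sol: "solution_on F E I \<gamma>" and s: "s \<in> I" "\<gamma> s \<in> N"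
  shows "solution_on F N I \<gamma>"
proof -
  define r v u where "r = fst \<circ> \<gamma>" and "v = fst \<circ> snd \<circ> \<gamma>" and "u = snd \<circ> snd \<circ> \<gamma>"
  have \<gamma>: "\<gamma> = (\<lambda>t. (r t, v t, u t))" by (auto simp: r_def v_def u_def)
  have I: "open I" "is_interval I" using sol by (auto simp: solution_on_def)
  have "(\<gamma> has_vector_derivative F (\<gamma> t)) (at t)" if "t \<in> I" for t
    using sol that by (simp add: solution_on_def)
  then have der: "(r has_real_derivative v t * r t) (at t)" "isCont v t"
    "(u has_real_derivative (\<alpha> - 2) / 2 * v t * u t) (at t)" if "t \<in> I" for t
    using that by (auto simp: \<gamma> reduced_field_def has_vector_derivative_triple_iff mult_ac
        dest: DERIV_isCont)
  have cont: "continuous_on I v" using der(2) by (intro continuous_at_imp_continuous_on) auto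
  have "\<gamma> t \<in> N" if "t \<in> I" for t
  proof -
    have "sgn (r t) = sgn (r s)"
      by (rule linear_scalar_equation_same_sign[OF I cont der(1) s(1) that])
    then have "0 < r t" using s(2) by (simp add: \<gamma> noncollision_surface_def flip: sgn_1_pos)
    moreover have "sgn (u t) = sgn (u s)"
      by (rule linear_scalar_equation_same_sign[OF I _ der(3) s(1) that])
         (intro continuous_intros cont)
    then have "u t \<noteq> 0" using s(2) by (auto simp: \<gamma> noncollision_surface_def sgn_0_0)
    moreover have "\<gamma> t \<in> E" using sol that by (simp add: solution_on_def)
    ultimately show ?thesis by (simp add: \<gamma> noncollision_surface_def)
  qed
  then show ?thesis using sol by (simp add: solution_on_def)
qed

text \<open>Relative equilibria are defined on the whole energy surface, whereas the conjugacy
  covers only its noncollision part; this links the two.\<close>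

lemma orbit_energy_surface:
  assumes "x \<in> N"
  shows "orbit F E x = orbit F N x"
proof -
  have "solution_on F N I \<gamma> \<Longrightarrow> solution_on F E I \<gamma>" for I \<gamma>
    by (auto simp: solution_on_def noncollision_surface_def)
  then have "solution_on F E I \<gamma> \<and> 0 \<in> I \<and> \<gamma> 0 = x \<and> t \<in> I \<longleftrightarrow>
      solution_on F N I \<gamma> \<and> 0 \<in> I \<and> \<gamma> 0 = x \<and> t \<in> I" for I \<gamma> t
    using solution_stays_noncollision assms by blast
  then show ?thesis unfolding orbit_def by simp
qed

definition r0 :: real where "r0 = sqrt m"

text \<open>The value of \<open>u\<close> at the pole where the angular momentum is
  \<open>\<rho>\<close> and the radius is \<open>r0\<close>.\<close>

definition u0 :: real where "u0 = \<rho> * r0 powr (p - 1)"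

lemma r0_pos: "0 < r0" and u0_pos: "0 < u0"
  using m \<rho> by (auto simp: r0_def u0_def)

lemma \<Psi>_pole: "\<Psi> (0, 0, \<rho>) = (r0, 0, u0)" "\<Psi> (0, 0, - \<rho>) = (r0, 0, - u0)"
  using S_X[of m] m by (auto simp: \<Psi>_def r0_def u0_def)

lemma pole_in_noncollision: "(r0, 0, u0) \<in> N" "(r0, 0, - u0) \<in> N"
  using \<Psi>_in[of "(0, 0, \<rho>)"] \<Psi>_in[of "(0, 0, - \<rho>)"] \<rho>(1) \<Psi>_pole
  by (auto simp: punctured_sphere_def)

text \<open>A zero of the field has \<open>v = 0\<close> and \<open>W' (r\<^sup>2) = 0\<close>,
  hence \<open>r\<^sup>2 = m\<close>, and the energy relation
  \<open>c\<^sup>2 = W m = \<rho>\<^sup>2\<close> leaves two values of \<open>u\<close>. Conversely,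
  these points are the poles of the sphere.\<close>

lemma fixed_points:
  "{(r, v, u) \<in> E. r > 0 \<and> fixed_point F E (r, v, u)} = {(r0, 0, u0), (r0, 0, - u0)}"
proof (intro equalityI subsetI)
  fix z assume "z \<in> {(r, v, u) \<in> E. r > 0 \<and> fixed_point F E (r, v, u)}"
  then obtain r v u where z: "z = (r, v, u)" and E: "(r, v, u) \<in> E" and r: "0 < r"
    and fp: "fixed_point F E (r, v, u)" by auto
  have "F (r, v, u) = 0" using fixed_point_imp_zero[OF fp] .
  then have v: "v = 0" and "W' (r\<^sup>2) = 0"
    using r unfolding reduced_field_eq[OF r E] by (auto simp: zero_prod_def)
  then have rm: "r\<^sup>2 = m"
    using W'_decreasing[of "r\<^sup>2" m] W'_decreasing[of m "r\<^sup>2"] m_critical r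
    by (cases "r\<^sup>2" m rule: linorder_cases) auto
  then have r0: "r = r0" using r by (simp add: r0_def real_sqrt_unique)
  have "(u * r powr (1 - p))\<^sup>2 = \<rho>\<^sup>2" using E energy_surface_iff[OF r] v rm \<rho>(2) by simp
  then have "u * r powr (1 - p) = \<rho> \<or> u * r powr (1 - p) = - \<rho>" by (simp add: power2_eq_iff)
  moreover have "u = u * r powr (1 - p) * r powr (p - 1)" using powr_cancel[OF r] by (simp add: mult.assoc)
  ultimately have "u = \<rho> * r powr (p - 1) \<or> u = - \<rho> * r powr (p - 1)" by metis
  then have "u = u0 \<or> u = - u0" by (simp add: u0_def r0)
  then show "z \<in> {(r0, 0, u0), (r0, 0, - u0)}" using z v r0 by auto
next
  fix z :: "real \<times> real \<times> real" assume "z \<in> {(r0, 0, u0), (r0, 0, - u0)}"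
  moreover have "orbit F E (r0, 0, u0) = {(r0, 0, u0)}"
    using orbit_pole[of \<rho>] \<rho>(1) by (simp add: orbit_energy_surface pole_in_noncollision \<Psi>_pole)
  moreover have "orbit F E (r0, 0, - u0) = {(r0, 0, - u0)}"
    using orbit_pole[of "- \<rho>"] \<rho>(1) by (simp add: orbit_energy_surface pole_in_noncollision \<Psi>_pole)
  ultimately show "z \<in> {(r, v, u) \<in> E. r > 0 \<and> fixed_point F E (r, v, u)}"
    using pole_in_noncollision r0_pos by (auto simp: fixed_point_def noncollision_surface_def)
qed

text \<open>A parallel of radius zero is a pole, and the poles correspond to the two excluded
  points.\<close>

lemma periodic_orbits:
  assumes "x \<in> N - {(r0, 0, u0), (r0, 0, - u0)}"
  shows "periodic_orbit F N (orbit F N x)"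
proof -
  have "x \<in> N" using assms by simp
  then obtain R c \<theta> where c: "c \<noteq> 0" "R\<^sup>2 + c\<^sup>2 = \<rho>\<^sup>2" and x: "x = \<Psi> (parallel R c \<theta>)"
    by (rule point_cases)
  have "R \<noteq> 0"
  proof
    assume R: "R = 0"
    then have "c = \<rho> \<or> c = - \<rho>" using c(2) by (simp add: power2_eq_iff)
    then show False using assms x R \<Psi>_pole by (auto simp: parallel_def)
  qed
  then show ?thesis unfolding x by (rule periodic_orbit_parallel[OF c])
qed

end

theorem mainTheorem1:
  fixes \<alpha> h \<epsilon> :: real
  assumes "0 < \<alpha>" and "\<alpha> < 2"
    and "h < 0"
    and "0 < \<epsilon>" and "\<epsilon> < \<bar>h\<bar> powr (- 1 / \<alpha>)"
  shows
    "(\<forall>\<delta>\<in>{0, \<epsilon>}. \<exists>r\<^sub>\<delta> u\<^sub>\<delta>. r\<^sub>\<delta> > 0 \<and> u\<^sub>\<delta> > 0 \<and>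
        {(r, v, u) \<in> energy_surface \<alpha> h \<delta>.
            r > 0 \<and> fixed_point (reduced_field \<alpha> \<delta>) (energy_surface \<alpha> h \<delta>) (r, v, u)}
          = {(r\<^sub>\<delta>, 0, u\<^sub>\<delta>), (r\<^sub>\<delta>, 0, - u\<^sub>\<delta>)} \<and>
        (\<forall>x \<in> noncollision_surface \<alpha> h \<delta> - {(r\<^sub>\<delta>, 0, u\<^sub>\<delta>), (r\<^sub>\<delta>, 0, - u\<^sub>\<delta>)}.
            periodic_orbit (reduced_field \<alpha> \<delta>) (noncollision_surface \<alpha> h \<delta>)
              (orbit (reduced_field \<alpha> \<delta>) (noncollision_surface \<alpha> h \<delta>) x)))
     \<and> topologically_equivalent
         (reduced_field \<alpha> 0) (noncollision_surface \<alpha> h 0)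
         (reduced_field \<alpha> \<epsilon>) (noncollision_surface \<alpha> h \<epsilon>)"
proof (intro conjI ballI)
  \<comment> \<open>The locale admits \<open>\<delta> = 0\<close>, so the real and the smoothed
    problem are two instances of the same rotation model.\<close>
  interpret A: smoothed_problem \<alpha> h 0 using assms by unfold_locales auto
  interpret B: smoothed_problem \<alpha> h \<epsilon> using assms by unfold_locales auto
  show "topologically_equivalent
         (reduced_field \<alpha> 0) (noncollision_surface \<alpha> h 0)
         (reduced_field \<alpha> \<epsilon>) (noncollision_surface \<alpha> h \<epsilon>)"
    by (rule topologically_equivalent_rotation_conjugates)
       (rule A.rotation_conjugate_axioms B.rotation_conjugate_axioms)+
next
  fix \<delta> assume "\<delta> \<in> {0, \<epsilon>}"
  then interpret smoothed_problem \<alpha> h \<delta> using assms by unfold_locales auto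
  show "\<exists>r\<^sub>\<delta> u\<^sub>\<delta>. r\<^sub>\<delta> > 0 \<and> u\<^sub>\<delta> > 0 \<and>
        {(r, v, u) \<in> energy_surface \<alpha> h \<delta>.
            r > 0 \<and> fixed_point (reduced_field \<alpha> \<delta>) (energy_surface \<alpha> h \<delta>) (r, v, u)}
          = {(r\<^sub>\<delta>, 0, u\<^sub>\<delta>), (r\<^sub>\<delta>, 0, - u\<^sub>\<delta>)} \<and>
        (\<forall>x \<in> noncollision_surface \<alpha> h \<delta> - {(r\<^sub>\<delta>, 0, u\<^sub>\<delta>), (r\<^sub>\<delta>, 0, - u\<^sub>\<delta>)}.
            periodic_orbit (reduced_field \<alpha> \<delta>) (noncollision_surface \<alpha> h \<delta>)
              (orbit (reduced_field \<alpha> \<delta>) (noncollision_surface \<alpha> h \<delta>) x))"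
    by (intro exI[of _ r0] exI[of _ u0] conjI ballI r0_pos u0_pos fixed_points periodic_orbits)
qed

end
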